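(* Let $K$ be an algebraically closed field, $Q$ a finite connected quiver, and $I\subseteq KQ$ a commutativity ideal or an anti-commutativity ideal. Then $I$ is admissible if and only if the generator graph $\Gamma_{I^\perp}$ of the orthogonal ideal $I^\perp$ does not contain any directed cycle.
   Context: Paths are composed left to right: for arrows $a,b$ of $Q$, $ab\neq 0$ in $KQ$ iff the target $\mathfrak t(a)$ equals the origin $\mathfrak o(b)$. A commutativity (resp. anti-commutativity) ideal is a two-sided ideal of $KQ$ generated by quadratic monomials $ab$ (paths of length 2) and relations $ab-ba$ (resp. $ab+ba$), $a,b$ arrows; a relation is a linear combination of parallel paths, so $a,b$ in such a relation are distinct loops at the same vertex. A minimal generating set $I_2$ of $I$ is a generating set of this type such that $ab-ba\in I_2$ (resp. $ab+ba\in I_2$) implies $ab\notin I_2$ and $ba\notin I_2$. The orthogonal ideal $I^\perp$ has minimal generating set $I_2^\perp$ consisting of: $ab+ba$ whenever $ab-ba\in I_2$; $ab-ba$ whenever $ab+ba\in I_2$; and every non-zero path $cd$ of length 2 (possibly $c=d$) such that $cd\notin I$ and $cd$ does not occur in an (anti-)commutativity generator of $I_2$. So $I^\perp$ is an anti-commutativity ideal if $I$ is a commutativity ideal, and vice versa. The generator graph $\Gamma_I$ has the arrows of $Q$ as vertices, a directed edge $a\to b$ for each (non-zero) monomial $ab\in I_2$ (a loop at $a$ for $a^2\in I_2$), and an undirected edge between $a$ and $b$ for each generator $ab-ba\in I_2$ or $ab+ba\in I_2$. A directed cycle is a non-empty sequence of directed edges $a_1\to a_2\to\dots\to a_n\to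 a_1$ (a loop $a\to a$ counts). $I$ is admissible if $J^m\subseteq I\subseteq J^2$ for some $m\ge 2$, where $J$ is the ideal generated by the arrows. *)

theory Defs
  imports
    "HOL-Computational_Algebra.Polynomial"
    "HOL-Algebra.Ideal_Product"
    "Graph_Theory.Arc_Walk"
    "Graph_Theory.Digraph_Component"
begin

section \<open>The path algebra of a quiver\<close>

text \<open>
  A quiver is a digraph with explicit arcs, so loops and multiple arrows are allowed.
  A path is a pair \<open>(u, p)\<close> of its origin \<open>u\<close> and its list of arrows \<open>p\<close>, composed from left to
  right; \<open>(u, [])\<close> is the trivial path at \<open>u\<close>.
\<close>

type_synonym ('v, 'a) path = "'v \<times> 'a list"

definition paths :: "('v, 'a) pre_digraph \<Rightarrow> ('v, 'a) path set" where
  "paths Q = {(u, p). \<exists>v. pre_digraph.awalk Q u p v}"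

definition path_target :: "('v, 'a) pre_digraph \<Rightarrow> 'v \<Rightarrow> 'a list \<Rightarrow> 'v" where
  "path_target Q u p = last (pre_digraph.awalk_verts Q u p)"

text \<open>
  An element of \<open>KQ\<close> is its finitely supported family of coefficients. The coefficient of a product
  at a path is the sum over all ways of cutting the path into an initial and a final part.
\<close>

definition path_algebra ::
    "('v, 'a) pre_digraph \<Rightarrow> (('v, 'a) path \<Rightarrow> 'k::field) ring" where
  "path_algebra Q =
    \<lparr> carrier = {x. finite {r. x r \<noteq> 0} \<and> {r. x r \<noteq> 0} \<subseteq> paths Q},
      mult = (\<lambda>x y (u, p). \<Sum>i\<le>length p.
                x (u, take i p) * y (path_target Q u (take i p), drop i p)),
      one = (\<lambda>(u, p). if u \<in> verts Q \<and> p = [] then 1 else 0),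
      zero = (\<lambda>_. 0),
      add = (\<lambda>x y r. x r + y r) \<rparr>"

definition arrow :: "('v, 'a) pre_digraph \<Rightarrow> 'a \<Rightarrow> ('v, 'a) path \<Rightarrow> 'k::field" where
  "arrow Q a = (\<lambda>r. if r = (tail Q a, [a]) then 1 else 0)"

definition quad :: "('v, 'a) pre_digraph \<Rightarrow> 'a \<Rightarrow> 'a \<Rightarrow> ('v, 'a) path \<Rightarrow> 'k::field" where
  "quad Q a b = arrow Q a \<otimes>\<^bsub>path_algebra Q\<^esub> arrow Q b"

section \<open>Admissible ideals\<close>

definition arrow_ideal :: "('v, 'a) pre_digraph \<Rightarrow> (('v, 'a) path \<Rightarrow> 'k::field) set" where
  "arrow_ideal Q = Idl\<^bsub>path_algebra Q\<^esub> (arrow Q ` arcs Q)"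

fun ideal_pow :: "('r, 'm) ring_scheme \<Rightarrow> 'r set \<Rightarrow> nat \<Rightarrow> 'r set" where
  "ideal_pow R J 0 = carrier R"
| "ideal_pow R J (Suc n) = ideal_prod R J (ideal_pow R J n)"

definition admissible ::
    "('v, 'a) pre_digraph \<Rightarrow> (('v, 'a) path \<Rightarrow> 'k::field) set \<Rightarrow> bool" where
  "admissible Q I \<longleftrightarrow>
     ideal I (path_algebra Q) \<and>
     (\<exists>m\<ge>2. ideal_pow (path_algebra Q) (arrow_ideal Q) m \<subseteq> I) \<and>
     I \<subseteq> ideal_pow (path_algebra Q) (arrow_ideal Q) 2"

section \<open>Commutativity and anti-commutativity ideals\<close>

definition composable :: "('v, 'a) pre_digraph \<Rightarrow> 'a \<Rightarrow> 'a \<Rightarrow> bool" where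
  "composable Q a b \<longleftrightarrow> a \<in> arcs Q \<and> b \<in> arcs Q \<and> head Q a = tail Q b"

definition distinct_loops :: "('v, 'a) pre_digraph \<Rightarrow> 'a \<Rightarrow> 'a \<Rightarrow> bool" where
  "distinct_loops Q a b \<longleftrightarrow> a \<in> arcs Q \<and> b \<in> arcs Q \<and> a \<noteq> b \<and>
     head Q a = tail Q a \<and> head Q b = tail Q b \<and> tail Q a = tail Q b"

definition commutator :: "('v, 'a) pre_digraph \<Rightarrow> 'a \<Rightarrow> 'a \<Rightarrow> ('v, 'a) path \<Rightarrow> 'k::field" where
  "commutator Q a b = quad Q a b \<ominus>\<^bsub>path_algebra Q\<^esub> quad Q b a"

definition anticommutator :: "('v, 'a) pre_digraph \<Rightarrow> 'a \<Rightarrow> 'a \<Rightarrow> ('v, 'a) path \<Rightarrow> 'k::field" where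
  "anticommutator Q a b = quad Q a b \<oplus>\<^bsub>path_algebra Q\<^esub> quad Q b a"

definition commutativity_relations ::
    "('v, 'a) pre_digraph \<Rightarrow> (('v, 'a) path \<Rightarrow> 'k::field) set" where
  "commutativity_relations Q =
     {quad Q a b | a b. composable Q a b} \<union> {commutator Q a b | a b. distinct_loops Q a b}"

definition anticommutativity_relations ::
    "('v, 'a) pre_digraph \<Rightarrow> (('v, 'a) path \<Rightarrow> 'k::field) set" where
  "anticommutativity_relations Q =
     {quad Q a b | a b. composable Q a b} \<union> {anticommutator Q a b | a b. distinct_loops Q a b}"

definition commutativity_ideal ::
    "('v, 'a) pre_digraph \<Rightarrow> (('v, 'a) path \<Rightarrow> 'k::field) set \<Rightarrow> bool" where
  "commutativity_ideal Q I \<longleftrightarrow>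
     (\<exists>S \<subseteq> commutativity_relations Q. I = Idl\<^bsub>path_algebra Q\<^esub> S)"

definition anticommutativity_ideal ::
    "('v, 'a) pre_digraph \<Rightarrow> (('v, 'a) path \<Rightarrow> 'k::field) set \<Rightarrow> bool" where
  "anticommutativity_ideal Q I \<longleftrightarrow>
     (\<exists>S \<subseteq> anticommutativity_relations Q. I = Idl\<^bsub>path_algebra Q\<^esub> S)"

text \<open>
  The (anti-)commutativity generators in \<open>S\<close> are only relevant up to sign, so \<open>ba - ab\<close>
  links \<open>a\<close> and \<open>b\<close> as well as \<open>ab - ba\<close> does.
\<close>

definition linked ::
    "('v, 'a) pre_digraph \<Rightarrow> (('v, 'a) path \<Rightarrow> 'k::field) set \<Rightarrow> 'a \<Rightarrow> 'a \<Rightarrow> bool" where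
  "linked Q S a b \<longleftrightarrow> distinct_loops Q a b \<and>
     (commutator Q a b \<in> S \<or> commutator Q b a \<in> S \<or> anticommutator Q a b \<in> S)"

definition minimal_generating_set ::
    "('v, 'a) pre_digraph \<Rightarrow> (('v, 'a) path \<Rightarrow> 'k::field) set \<Rightarrow>
     (('v, 'a) path \<Rightarrow> 'k) set \<Rightarrow> bool" where
  "minimal_generating_set Q I S \<longleftrightarrow>
     (S \<subseteq> commutativity_relations Q \<or> S \<subseteq> anticommutativity_relations Q) \<and>
     I = Idl\<^bsub>path_algebra Q\<^esub> S \<and>
     (\<forall>a b. linked Q S a b \<longrightarrow> quad Q a b \<notin> S \<and> quad Q b a \<notin> S)"

section \<open>The orthogonal ideal and the generator graph\<close>

definition orthogonal_generators ::
    "('v, 'a) pre_digraph \<Rightarrow> (('v, 'a) path \<Rightarrow> 'k::field) set \<Rightarrow>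
     (('v, 'a) path \<Rightarrow> 'k) set \<Rightarrow> (('v, 'a) path \<Rightarrow> 'k) set" where
  "orthogonal_generators Q I S =
     {anticommutator Q a b | a b. distinct_loops Q a b \<and> commutator Q a b \<in> S} \<union>
     {commutator Q a b | a b. distinct_loops Q a b \<and> anticommutator Q a b \<in> S} \<union>
     {quad Q c d | c d. composable Q c d \<and> quad Q c d \<notin> I \<and> \<not> linked Q S c d}"

definition orthogonal_ideal ::
    "('v, 'a) pre_digraph \<Rightarrow> (('v, 'a) path \<Rightarrow> 'k::field) set \<Rightarrow>
     (('v, 'a) path \<Rightarrow> 'k) set \<Rightarrow> (('v, 'a) path \<Rightarrow> 'k) set" where
  "orthogonal_ideal Q I S = Idl\<^bsub>path_algebra Q\<^esub> (orthogonal_generators Q I S)"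

record 'a mixed_graph =
  vertices :: "'a set"
  directed_edges :: "('a \<times> 'a) set"
  undirected_edges :: "'a set set"

definition generator_graph ::
    "('v, 'a) pre_digraph \<Rightarrow> (('v, 'a) path \<Rightarrow> 'k::field) set \<Rightarrow> 'a mixed_graph" where
  "generator_graph Q S =
    \<lparr> vertices = arcs Q,
      directed_edges = {(a, b). composable Q a b \<and> quad Q a b \<in> S},
      undirected_edges = {{a, b} | a b. linked Q S a b} \<rparr>"

definition has_directed_cycle :: "'a mixed_graph \<Rightarrow> bool" where
  "has_directed_cycle G \<longleftrightarrow>
     (\<exists>as. as \<noteq> [] \<and>
        (\<forall>i < length as. (as ! i, as ! (Suc i mod length as)) \<in> directed_edges G))"

section \<open>The path algebra is a ring\<close>

lemma path_target_Nil [simp]: "path_target Q u [] = u"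
  by (simp add: path_target_def pre_digraph.awalk_verts.simps)

lemma path_target_append:
  "path_target Q u (p @ q) = path_target Q (path_target Q u p) q"
  by (simp add: path_target_def pre_digraph.awalk_verts_conv)

lemma path_target_awalk: "pre_digraph.awalk Q u p v \<Longrightarrow> path_target Q u p = v"
proof -
  have "path_target Q u p = v" if "pre_digraph.cas Q u p v" for u
    using that
    by (induction p arbitrary: u)
      (auto simp: path_target_def pre_digraph.cas.simps pre_digraph.awalk_verts_conv
        split: if_splits)
  then show "pre_digraph.awalk Q u p v \<Longrightarrow> path_target Q u p = v"
    by (simp add: pre_digraph.awalk_def)
qed

lemma cas_append:
  "pre_digraph.cas Q u p v \<Longrightarrow> pre_digraph.cas Q v q w \<Longrightarrow> pre_digraph.cas Q u (p @ q) w"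
  by (induction p arbitrary: u) (auto simp: pre_digraph.cas.simps)

lemma paths_append:
  assumes "(u, p) \<in> paths Q" "(path_target Q u p, q) \<in> paths Q"
  shows "(u, p @ q) \<in> paths Q"
proof -
  obtain v w where 1: "pre_digraph.awalk Q u p v"
    and 2: "pre_digraph.awalk Q (path_target Q u p) q w"
    using assms by (auto simp: paths_def)
  from path_target_awalk[OF 1] 2 have 3: "pre_digraph.awalk Q v q w" by simp
  from 1 3 have "pre_digraph.awalk Q u (p @ q) w"
    by (auto simp: pre_digraph.awalk_def intro: cas_append)
  then show ?thesis by (auto simp: paths_def)
qed

lemma path_algebra_carrier:
  "x \<in> carrier (path_algebra Q) \<longleftrightarrow> finite {r. x r \<noteq> 0} \<and> {r. x r \<noteq> 0} \<subseteq> paths Q"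
  by (simp add: path_algebra_def)

lemma path_algebra_mult:
  "(x \<otimes>\<^bsub>path_algebra Q\<^esub> y) (u, p) =
     (\<Sum>i\<le>length p. x (u, take i p) * y (path_target Q u (take i p), drop i p))"
  by (simp add: path_algebra_def)

lemma path_algebra_add: "(x \<oplus>\<^bsub>path_algebra Q\<^esub> y) = (\<lambda>r. x r + y r)"
  by (simp add: path_algebra_def)

lemma path_algebra_zero: "\<zero>\<^bsub>path_algebra Q\<^esub> = (\<lambda>_. 0)"
  by (simp add: path_algebra_def)

lemma path_algebra_one:
  "\<one>\<^bsub>path_algebra Q\<^esub> = (\<lambda>(u, p). if u \<in> verts Q \<and> p = [] then 1 else 0)"
  by (simp add: path_algebra_def)

lemma path_algebra_mult_closed:
  assumes "x \<in> carrier (path_algebra Q)" "y \<in> carrier (path_algebra Q)"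
  shows "x \<otimes>\<^bsub>path_algebra Q\<^esub> y \<in> carrier (path_algebra Q)"
proof -
  let ?xy = "x \<otimes>\<^bsub>path_algebra Q\<^esub> y"
  have cut: "\<exists>q q'. p = q @ q' \<and> x (u, q) \<noteq> 0 \<and> y (path_target Q u q, q') \<noteq> 0"
    if "?xy (u, p) \<noteq> 0" for u p
  proof -
    from that obtain i where
      "x (u, take i p) * y (path_target Q u (take i p), drop i p) \<noteq> 0"
      unfolding path_algebra_mult by (meson sum.neutral)
    then show ?thesis
      by (intro exI[of _ "take i p"] exI[of _ "drop i p"]) auto
  qed
  have "{r. ?xy r \<noteq> 0} \<subseteq>
      (\<lambda>(r, s). (fst r, snd r @ snd s)) ` ({r. x r \<noteq> 0} \<times> {r. y r \<noteq> 0})"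
    using cut by (force simp: image_iff)
  then have "finite {r. ?xy r \<noteq> 0}"
    by (rule finite_subset) (use assms in \<open>simp add: path_algebra_carrier\<close>)
  moreover have "{r. ?xy r \<noteq> 0} \<subseteq> paths Q"
  proof
    fix r assume r: "r \<in> {r. ?xy r \<noteq> 0}"
    obtain u p where "r = (u, p)" by (cases r)
    with r cut[of u p] obtain q q' where
      "r = (u, q @ q')" "x (u, q) \<noteq> 0" "y (path_target Q u q, q') \<noteq> 0"
      by auto
    with assms show "r \<in> paths Q"
      by (auto simp: path_algebra_carrier intro!: paths_append)
  qed
  ultimately show ?thesis by (simp add: path_algebra_carrier)
qed

lemma path_algebra_mult_assoc:
  "(x \<otimes>\<^bsub>path_algebra Q\<^esub> y) \<otimes>\<^bsub>path_algebra Q\<^esub> z =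
     x \<otimes>\<^bsub>path_algebra Q\<^esub> (y \<otimes>\<^bsub>path_algebra Q\<^esub> z)"
proof (rule ext, clarify)
  fix u :: 'a and p :: "'b list"
  let ?n = "length p"
  define t where "t i = path_target Q u (take i p)" for i
  define f where
    "f i j = x (u, take i p) * y (t i, take j (drop i p)) * z (t (i + j), drop (i + j) p)" for i j
  have "((x \<otimes>\<^bsub>path_algebra Q\<^esub> y) \<otimes>\<^bsub>path_algebra Q\<^esub> z) (u, p) = (\<Sum>k\<le>?n. \<Sum>i\<le>k. f i (k - i))"
    unfolding path_algebra_mult sum_distrib_right
    by (intro sum.cong refl) (auto simp: f_def t_def min_def drop_take)
  also have "\<dots> = (\<Sum>(i, j)\<in>{(i, j). i + j \<le> ?n}. f i j)"
    by (rule sum.triangle_reindex_eq[symmetric])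
  also have "{(i, j). i + j \<le> ?n} = (SIGMA i:{..?n}. {..?n - i})"
    by auto
  also have "(\<Sum>(i, j)\<in>(SIGMA i:{..?n}. {..?n - i}). f i j) = (\<Sum>i\<le>?n. \<Sum>j\<le>?n - i. f i j)"
    by (rule sum.Sigma[symmetric]) auto
  also have "\<dots> = (x \<otimes>\<^bsub>path_algebra Q\<^esub> (y \<otimes>\<^bsub>path_algebra Q\<^esub> z)) (u, p)"
    unfolding path_algebra_mult sum_distrib_left
    by (intro sum.cong refl)
      (auto simp: f_def t_def mult.assoc take_add path_target_append add.commute)
  finally show "((x \<otimes>\<^bsub>path_algebra Q\<^esub> y) \<otimes>\<^bsub>path_algebra Q\<^esub> z) (u, p) =
    (x \<otimes>\<^bsub>path_algebra Q\<^esub> (y \<otimes>\<^bsub>path_algebra Q\<^esub> z)) (u, p)" .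
qed

lemma path_algebra_ring:
  assumes "fin_digraph Q"
  shows "ring (path_algebra Q :: (('v, 'a) path \<Rightarrow> 'k::field) ring)"
    (is "ring ?R")
proof -
  interpret fin_digraph Q by fact
  have one_closed: "\<one>\<^bsub>?R\<^esub> \<in> carrier ?R"
  proof -
    have "{r. \<one>\<^bsub>?R\<^esub> r \<noteq> 0} = (\<lambda>u. (u, [])) ` verts Q"
      by (auto simp: path_algebra_one split: if_splits)
    then show ?thesis
      by (auto simp: path_algebra_carrier paths_def awalk_def)
  qed
  have l_one: "\<one>\<^bsub>?R\<^esub> \<otimes>\<^bsub>?R\<^esub> x = x" if "x \<in> carrier ?R" for x
  proof (rule ext, clarify)
    fix u p
    have "(\<one>\<^bsub>?R\<^esub> \<otimes>\<^bsub>?R\<^esub> x) (u, p) =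
        (\<Sum>i\<le>length p. if i = 0 then (if u \<in> verts Q then x (u, p) else 0) else 0)"
      unfolding path_algebra_mult path_algebra_one by (intro sum.cong) auto
    also have "\<dots> = x (u, p)"
      using that by (auto simp: path_algebra_carrier paths_def awalk_def)
    finally show "(\<one>\<^bsub>?R\<^esub> \<otimes>\<^bsub>?R\<^esub> x) (u, p) = x (u, p)" .
  qed
  have r_one: "x \<otimes>\<^bsub>?R\<^esub> \<one>\<^bsub>?R\<^esub> = x" if "x \<in> carrier ?R" for x
  proof (rule ext, clarify)
    fix u p
    have "(x \<otimes>\<^bsub>?R\<^esub> \<one>\<^bsub>?R\<^esub>) (u, p) =
        (\<Sum>i\<le>length p. if i = length p then (if path_target Q u p \<in> verts Q then x (u, p) else 0) else 0)"
      unfolding path_algebra_mult path_algebra_one by (intro sum.cong) auto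
    also have "\<dots> = (if path_target Q u p \<in> verts Q then x (u, p) else 0)"
      by simp
    also have "\<dots> = x (u, p)"
      using that by (auto simp: path_algebra_carrier paths_def dest: path_target_awalk)
    finally show "(x \<otimes>\<^bsub>?R\<^esub> \<one>\<^bsub>?R\<^esub>) (u, p) = x (u, p)" .
  qed
  have add_closed: "x \<oplus>\<^bsub>?R\<^esub> y \<in> carrier ?R" if "x \<in> carrier ?R" "y \<in> carrier ?R" for x y
  proof -
    have sub: "{r. x r + y r \<noteq> 0} \<subseteq> {r. x r \<noteq> 0} \<union> {r. y r \<noteq> 0}" by auto
    have "finite {r. x r + y r \<noteq> 0}"
      by (rule finite_subset[OF sub]) (use that in \<open>simp add: path_algebra_carrier\<close>)
    with sub that show ?thesis by (auto simp: path_algebra_carrier path_algebra_add)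
  qed
  have minus: "\<exists>y\<in>carrier ?R. y \<oplus>\<^bsub>?R\<^esub> x = \<zero>\<^bsub>?R\<^esub>" if "x \<in> carrier ?R" for x
    by (rule bexI[of _ "\<lambda>r. - x r"])
      (use that in \<open>simp_all add: path_algebra_add path_algebra_zero path_algebra_carrier\<close>)
  show ?thesis
  proof (intro ringI abelian_groupI monoidI)
    fix x y z
    show "(x \<oplus>\<^bsub>?R\<^esub> y) \<otimes>\<^bsub>?R\<^esub> z = x \<otimes>\<^bsub>?R\<^esub> z \<oplus>\<^bsub>?R\<^esub> y \<otimes>\<^bsub>?R\<^esub> z"
      unfolding path_algebra_add
      by (rule ext, clarify) (simp add: path_algebra_mult distrib_right sum.distrib)
    show "z \<otimes>\<^bsub>?R\<^esub> (x \<oplus>\<^bsub>?R\<^esub> y) = z \<otimes>\<^bsub>?R\<^esub> x \<oplus>\<^bsub>?R\<^esub> z \<otimes>\<^bsub>?R\<^esub> y"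
      unfolding path_algebra_add
      by (rule ext, clarify) (simp add: path_algebra_mult distrib_left sum.distrib)
  qed (auto simp: one_closed l_one r_one minus add_closed path_algebra_mult_closed
      path_algebra_mult_assoc, auto simp: path_algebra_add path_algebra_zero path_algebra_carrier
      add.assoc add.commute)
qed


section \<open>Existence of minimal generating sets\<close>

lemma quad_eq:
  "(quad Q a b :: _ \<Rightarrow> 'k::field) =
    (\<lambda>r. if head Q a = tail Q b \<and> r = (tail Q a, [a, b]) then 1 else 0)"
proof (rule ext, clarify)
  fix u p
  have "(quad Q a b :: _ \<Rightarrow> 'k) (u, p) = (\<Sum>i\<le>length p. if i = 1 then
      (if head Q a = tail Q b \<and> (u, p) = (tail Q a, [a, b]) then 1 else 0) else 0)"
    unfolding quad_def path_algebra_mult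
  proof (rule sum.cong)
    fix i assume i: "i \<in> {..length p}"
    show "arrow Q a (u, take i p) * arrow Q b (path_target Q u (take i p), drop i p) =
      (if i = 1 then
        (if head Q a = tail Q b \<and> (u, p) = (tail Q a, [a, b]) then 1 else (0 :: 'k)) else 0)"
    proof (cases "u = tail Q a \<and> take i p = [a] \<and> drop i p = [b]")
      case True
      then have "p = [a, b]" by (metis append_take_drop_id append_Cons append_Nil)
      moreover from True i have "i = 1"
        by (metis One_nat_def length_Cons length_take list.size(3) min.absorb2 atMost_iff)
      ultimately show ?thesis using True
        by (auto simp: arrow_def path_target_def pre_digraph.awalk_verts.simps)
    next
      case False
      then show ?thesis by (auto simp: arrow_def)
    qed
  qed simp
  also have "\<dots> = (if head Q a = tail Q b \<and> (u, p) = (tail Q a, [a, b]) then 1 else 0)"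
    by auto
  finally show "(quad Q a b :: _ \<Rightarrow> 'k) (u, p) =
    (if head Q a = tail Q b \<and> (u, p) = (tail Q a, [a, b]) then 1 else 0)" .
qed

context
  fixes Q :: "('v, 'a) pre_digraph" and R :: "(('v, 'a) path \<Rightarrow> 'k::field) ring"
  assumes fin: "fin_digraph Q"
  defines R_def: "R \<equiv> path_algebra Q"
begin

interpretation fin_digraph Q by (fact fin)

interpretation ring R
  unfolding R_def by (rule path_algebra_ring[OF fin])

lemma quad_closed:
  assumes "a \<in> arcs Q" "b \<in> arcs Q"
  shows "(quad Q a b :: _ \<Rightarrow> 'k) \<in> carrier R"
proof -
  have "(arrow Q e :: _ \<Rightarrow> 'k) \<in> carrier R" if "e \<in> arcs Q" for e
  proof -
    have "{r. (arrow Q e :: _ \<Rightarrow> 'k) r \<noteq> 0} = {(tail Q e, [e])}"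
      by (auto simp: arrow_def)
    moreover have "(tail Q e, [e]) \<in> paths Q"
      using that by (auto simp: paths_def awalk_def)
    ultimately show ?thesis
      unfolding R_def path_algebra_carrier by simp
  qed
  with assms show ?thesis
    unfolding quad_def R_def[symmetric] by simp
qed

lemma path_algebra_minus:
  assumes "x \<in> carrier R" "y \<in> carrier R"
  shows "x \<ominus>\<^bsub>R\<^esub> y = (\<lambda>r. x r - y r)"
proof -
  have "(x \<ominus>\<^bsub>R\<^esub> y) \<oplus>\<^bsub>R\<^esub> y = x"
    using assms by (simp add: a_minus_def a_assoc l_neg)
  then have "(x \<ominus>\<^bsub>R\<^esub> y) r + y r = x r" for r
    unfolding R_def path_algebra_add by metis
  then show ?thesis by (simp add: fun_eq_iff eq_diff_eq)
qed

lemma commutator_eq: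
  assumes "distinct_loops Q a b"
  shows "(commutator Q a b :: _ \<Rightarrow> 'k) =
    (\<lambda>r. if r = (tail Q a, [a, b]) then 1 else if r = (tail Q a, [b, a]) then - 1 else 0)"
proof -
  have "(commutator Q a b :: _ \<Rightarrow> 'k) = (\<lambda>r. quad Q a b r - quad Q b a r)"
    using assms path_algebra_minus[OF quad_closed quad_closed]
    by (simp add: commutator_def distinct_loops_def R_def)
  also have "\<dots> =
    (\<lambda>r. if r = (tail Q a, [a, b]) then 1 else if r = (tail Q a, [b, a]) then - 1 else 0)"
    using assms by (auto simp: quad_eq distinct_loops_def fun_eq_iff)
  finally show ?thesis .
qed

lemma anticommutator_eq:
  assumes "distinct_loops Q a b"
  shows "(anticommutator Q a b :: _ \<Rightarrow> 'k) =
    (\<lambda>r. if r = (tail Q a, [a, b]) then 1 else if r = (tail Q a, [b, a]) then 1 else 0)"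
  using assms
  by (auto simp: anticommutator_def path_algebra_add quad_eq distinct_loops_def fun_eq_iff)

lemma quad_inj:
  assumes "(quad Q a b :: _ \<Rightarrow> 'k) = quad Q c d" "composable Q a b"
  shows "a = c \<and> b = d"
proof -
  have "(quad Q c d :: _ \<Rightarrow> 'k) (tail Q a, [a, b]) = 1"
    using assms by (metis quad_eq composable_def)
  then show ?thesis by (auto simp: quad_eq split: if_splits)
qed

lemma relation_support:
  assumes "distinct_loops Q a b"
  shows "{r. (commutator Q a b :: _ \<Rightarrow> 'k) r \<noteq> 0} = {(tail Q a, [a, b]), (tail Q a, [b, a])}"
    and "{r. (anticommutator Q a b :: _ \<Rightarrow> 'k) r \<noteq> 0} = {(tail Q a, [a, b]), (tail Q a, [b, a])}"
  by (auto simp: commutator_eq[OF assms] anticommutator_eq[OF assms])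

lemma relation_neq_quad:
  assumes "distinct_loops Q a b"
  shows "(commutator Q a b :: _ \<Rightarrow> 'k) \<noteq> quad Q c d"
    and "(anticommutator Q a b :: _ \<Rightarrow> 'k) \<noteq> quad Q c d"
proof -
  have ab: "a \<noteq> b" using assms unfolding distinct_loops_def by blast
  let ?L = "{(tail Q a, [a, b]), (tail Q a, [b, a])}"
  have sub: "{r. (quad Q c d :: _ \<Rightarrow> 'k) r \<noteq> 0} \<subseteq> {(tail Q c, [c, d])}"
    unfolding quad_eq by (rule subsetI) (simp split: if_splits)
  have q: "?L \<noteq> {r. (quad Q c d :: _ \<Rightarrow> 'k) r \<noteq> 0}"
  proof
    assume eq: "?L = {r. (quad Q c d :: _ \<Rightarrow> 'k) r \<noteq> 0}"
    have r: "hd (snd r) = c" if "r \<in> ?L" for r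
    proof -
      have "r = (tail Q c, [c, d])"
        using subsetD[OF sub that[unfolded eq]] by (rule singletonD)
      then show ?thesis by simp
    qed
    have "a = c" using r[of "(tail Q a, [a, b])"] by simp
    moreover have "b = c" using r[of "(tail Q a, [b, a])"] by simp
    ultimately show False using ab by blast
  qed
  show "(commutator Q a b :: _ \<Rightarrow> 'k) \<noteq> quad Q c d"
  proof
    assume "(commutator Q a b :: _ \<Rightarrow> 'k) = quad Q c d"
    from relation_support(1)[OF assms, unfolded this] q show False by simp
  qed
  show "(anticommutator Q a b :: _ \<Rightarrow> 'k) \<noteq> quad Q c d"
  proof
    assume "(anticommutator Q a b :: _ \<Rightarrow> 'k) = quad Q c d"
    from relation_support(2)[OF assms, unfolded this] q show False by simp
  qed
qed

lemma distinct_loops_commute: "distinct_loops Q a b \<Longrightarrow> distinct_loops Q b a"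
  unfolding distinct_loops_def by metis

lemma relation_determines_loops:
  assumes "distinct_loops Q a b" "distinct_loops Q c d"
    and "(f :: _ \<Rightarrow> 'k) \<in> {commutator Q a b, commutator Q b a, anticommutator Q a b}"
    and "f \<in> {commutator Q c d, commutator Q d c, anticommutator Q c d}"
  shows "{a, b} = {c, d}"
proof -
  have sw: "distinct_loops Q b a" "distinct_loops Q d c"
    using assms(1,2) distinct_loops_commute by blast+
  have supp: "{r. f r \<noteq> 0} = {(tail Q x, [x, y]), (tail Q x, [y, x])}"
    if "distinct_loops Q x y" "distinct_loops Q y x"
      "f \<in> {commutator Q x y, commutator Q y x, anticommutator Q x y}" for x y
  proof -
    have t: "tail Q y = tail Q x" using that(1) by (simp add: distinct_loops_def)
    from that(3) consider "f = commutator Q x y" | "f = commutator Q y x" | "f = anticommutator Q x y"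
      by blast
    then show ?thesis
    proof cases
      case 1
      show ?thesis unfolding 1 by (rule relation_support(1)[OF that(1)])
    next
      case 2
      show ?thesis unfolding 2 relation_support(1)[OF that(2)] t by (rule insert_commute)
    next
      case 3
      show ?thesis unfolding 3 by (rule relation_support(2)[OF that(1)])
    qed
  qed
  have "{(tail Q a, [a, b]), (tail Q a, [b, a])} = {(tail Q c, [c, d]), (tail Q c, [d, c])}"
    using supp[OF assms(1) sw(1) assms(3)] supp[OF assms(2) sw(2) assms(4)] by (rule trans[OF sym])
  then have "(tail Q a, [a, b]) \<in> {(tail Q c, [c, d]), (tail Q c, [d, c])}"
    by (rule subsetD[OF equalityD1]) (rule insertI1)
  then have "[a, b] = [c, d] \<or> [a, b] = [d, c]" by blast
  then show ?thesis by (elim disjE) auto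
qed

lemma anticommutator_commute: "(anticommutator Q a b :: _ \<Rightarrow> 'k) = anticommutator Q b a"
  unfolding anticommutator_def path_algebra_add by (rule ext) (rule Groups.add.commute)

lemma linked_commute:
  assumes "linked Q (S :: (_ \<Rightarrow> 'k) set) a b"
  shows "linked Q S b a"
  using assms distinct_loops_commute[of a b]
  unfolding linked_def anticommutator_commute[of b a] by blast

lemma generators_closed:
  "commutativity_relations Q \<subseteq> carrier R"
  "anticommutativity_relations Q \<subseteq> carrier R"
proof -
  have q: "(quad Q a b :: _ \<Rightarrow> 'k) \<in> carrier R" if "composable Q a b" for a b
    using that quad_closed by (simp add: composable_def)
  have "commutator Q a b \<in> carrier R" "anticommutator Q a b \<in> carrier R"
    if "distinct_loops Q a b" for a b
    using that unfolding commutator_def anticommutator_def R_def[symmetric] distinct_loops_def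
    by (simp_all add: quad_closed)
  with q show "commutativity_relations Q \<subseteq> carrier R" "anticommutativity_relations Q \<subseteq> carrier R"
    unfolding commutativity_relations_def anticommutativity_relations_def by blast+
qed

lemma relation_mem_ideal:
  assumes "ideal I R" "distinct_loops Q a b"
    and "commutator Q a b \<in> I \<or> anticommutator Q a b \<in> I"
  shows "quad Q a b \<in> I \<longleftrightarrow> quad Q b a \<in> I"
proof -
  interpret I: ideal I R by fact
  let ?x = "quad Q a b :: _ \<Rightarrow> 'k" and ?y = "quad Q b a :: _ \<Rightarrow> 'k"
  have xy: "?x \<in> carrier R" "?y \<in> carrier R"
    using assms(2) quad_closed by (auto simp: distinct_loops_def)
  have com: "?x \<oplus>\<^bsub>R\<^esub> ?y = ?y \<oplus>\<^bsub>R\<^esub> ?x" using xy by (simp add: a_comm)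
  have 1: "u \<in> I \<Longrightarrow> v \<in> carrier R \<Longrightarrow> u \<oplus>\<^bsub>R\<^esub> v \<in> I \<Longrightarrow> v \<in> I" for u v
  proof -
    assume u: "u \<in> I" and v: "v \<in> carrier R" and s: "u \<oplus>\<^bsub>R\<^esub> v \<in> I"
    have uc: "u \<in> carrier R" using u I.a_subset by auto
    have "\<ominus>\<^bsub>R\<^esub> u \<oplus>\<^bsub>R\<^esub> (u \<oplus>\<^bsub>R\<^esub> v) \<in> I" using u s by simp
    also have "\<ominus>\<^bsub>R\<^esub> u \<oplus>\<^bsub>R\<^esub> (u \<oplus>\<^bsub>R\<^esub> v) = v" using uc v by (simp add: r_neg1)
    finally show "v \<in> I" .
  qed
  have 2: "?y \<in> I" if "\<ominus>\<^bsub>R\<^esub> ?y \<in> I"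
    using I.a_inv_closed[OF that] xy by simp
  from assms(3) show ?thesis
  proof
    assume "commutator Q a b \<in> I"
    then have m: "?x \<oplus>\<^bsub>R\<^esub> \<ominus>\<^bsub>R\<^esub> ?y \<in> I"
      by (simp add: commutator_def R_def a_minus_def)
    then have m': "\<ominus>\<^bsub>R\<^esub> ?y \<oplus>\<^bsub>R\<^esub> ?x \<in> I" using xy by (simp add: a_comm)
    show ?thesis
    proof
      assume "?x \<in> I"
      with 1[OF this _ m] 2 xy show "?y \<in> I" by simp
    next
      assume "?y \<in> I"
      then have "\<ominus>\<^bsub>R\<^esub> ?y \<in> I" by simp
      with 1[OF this _ m'] xy show "?x \<in> I" by simp
    qed
  next
    assume "anticommutator Q a b \<in> I"
    then have m: "?x \<oplus>\<^bsub>R\<^esub> ?y \<in> I"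
      by (simp add: anticommutator_def R_def)
    then have "?y \<oplus>\<^bsub>R\<^esub> ?x \<in> I" using com by simp
    with m show ?thesis using 1[of ?x ?y] 1[of ?y ?x] xy by blast
  qed
qed

lemma minimal_generating_set_exists:
  assumes "commutativity_ideal Q I \<or> anticommutativity_ideal Q (I :: (_ \<Rightarrow> 'k) set)"
  shows "\<exists>S. minimal_generating_set Q I S"
proof -
  obtain rel :: "'a \<Rightarrow> 'a \<Rightarrow> ('v, 'a) path \<Rightarrow> 'k"
    and C S :: "(('v, 'a) path \<Rightarrow> 'k) set" where
    rel: "(rel = commutator Q \<and> C = commutativity_relations Q) \<or>
      (rel = anticommutator Q \<and> C = anticommutativity_relations Q)"
    and S: "S \<subseteq> C" "I = Idl\<^bsub>R\<^esub> S"
    using assms unfolding commutativity_ideal_def anticommutativity_ideal_def R_def by metis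
  have C: "C = {quad Q a b | a b. composable Q a b} \<union> {rel a b | a b. distinct_loops Q a b}"
    using rel by (auto simp: commutativity_relations_def anticommutativity_relations_def)
  have SC: "S \<subseteq> carrier R" using S(1) rel generators_closed by auto
  interpret I: ideal I R unfolding S(2) by (rule genideal_ideal[OF SC])
  have SI: "S \<subseteq> I" unfolding S(2) by (rule genideal_self[OF SC])
  define T where "T = {quad Q a b | a b. composable Q a b \<and> quad Q a b \<in> I} \<union>
    {rel a b | a b. distinct_loops Q a b \<and> rel a b \<in> S \<and> quad Q a b \<notin> I}"
  have TC: "T \<subseteq> C" unfolding T_def C by auto
  then have TR: "T \<subseteq> carrier R" using rel generators_closed by auto
  interpret T: ideal "Idl\<^bsub>R\<^esub> T" R by (rule genideal_ideal[OF TR])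
  have Tself: "T \<subseteq> Idl\<^bsub>R\<^esub> T" by (rule genideal_self[OF TR])
  have TI: "T \<subseteq> I" unfolding T_def using SI by auto
  have mem: "quad Q a b \<in> I \<longleftrightarrow> quad Q b a \<in> I" if "distinct_loops Q a b" "rel a b \<in> I" for a b
    using relation_mem_ideal[OF I.is_ideal that(1)] that(2) rel by auto
  have "S \<subseteq> Idl\<^bsub>R\<^esub> T"
  proof
    fix g assume g: "g \<in> S"
    with S(1) consider a b where "g = quad Q a b" "composable Q a b"
      | a b where "g = rel a b" "distinct_loops Q a b"
      unfolding C by blast
    then show "g \<in> Idl\<^bsub>R\<^esub> T"
    proof cases
      case 1
      then have "g \<in> T" unfolding T_def using g SI by auto
      then show ?thesis using Tself by auto
    next
      case 2
      show ?thesis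
      proof (cases "quad Q a b \<in> I")
        case False
        then have "g \<in> T" unfolding T_def using g 2 by auto
        then show ?thesis using Tself by auto
      next
        case True
        then have "quad Q b a \<in> I" using mem[of a b] 2 g SI by auto
        with True have "quad Q a b \<in> T" "quad Q b a \<in> T"
          using 2(2) unfolding T_def composable_def distinct_loops_def by auto
        then have q: "quad Q a b \<in> Idl\<^bsub>R\<^esub> T" "quad Q b a \<in> Idl\<^bsub>R\<^esub> T"
          using Tself by auto
        show ?thesis
          using rel
        proof
          assume "rel = commutator Q \<and> C = commutativity_relations Q"
          then have "g = quad Q a b \<oplus>\<^bsub>R\<^esub> \<ominus>\<^bsub>R\<^esub> quad Q b a"
            by (simp add: 2(1) commutator_def R_def a_minus_def)
          with q show ?thesis by simp
        next
          assume "rel = anticommutator Q \<and> C = anticommutativity_relations Q"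
          then have "g = quad Q a b \<oplus>\<^bsub>R\<^esub> quad Q b a"
            by (simp add: 2(1) anticommutator_def R_def)
          with q show ?thesis by simp
        qed
      qed
    qed
  qed
  then have "I \<subseteq> Idl\<^bsub>R\<^esub> T" unfolding S(2) by (rule genideal_minimal[OF T.is_ideal])
  moreover have "Idl\<^bsub>R\<^esub> T \<subseteq> I" by (rule genideal_minimal[OF I.is_ideal TI])
  ultimately have gen: "I = Idl\<^bsub>path_algebra Q\<^esub> T" unfolding R_def by auto
  have min: "quad Q a b \<notin> T \<and> quad Q b a \<notin> T" if l: "linked Q T a b" for a b
  proof -
    have ab: "distinct_loops Q a b" "distinct_loops Q b a"
      using l by (auto simp: linked_def distinct_loops_def)
    obtain g where g: "g \<in> T" "g \<in> {commutator Q a b, commutator Q b a, anticommutator Q a b}"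
      using l by (auto simp: linked_def)
    have "g \<noteq> quad Q c d" for c d
      using g(2)
    proof (elim insertE emptyE)
    qed (use relation_neq_quad[OF ab(1), of c d] relation_neq_quad(1)[OF ab(2), of c d] in auto)
    with g(1) obtain c d where cd: "g = rel c d" "distinct_loops Q c d" "g \<in> S" "quad Q c d \<notin> I"
      unfolding T_def by auto
    have "quad Q d c \<notin> I" using mem[of c d] cd SI by auto
    moreover have "{a, b} = {c, d}"
      using relation_determines_loops[OF ab(1) cd(2) g(2)] cd(1) rel by auto
    ultimately have "quad Q a b \<notin> I" "quad Q b a \<notin> I"
      using cd(4) by (auto simp: doubleton_eq_iff)
    with TI show ?thesis by auto
  qed
  show ?thesis
    unfolding minimal_generating_set_def using TC rel gen min by (intro exI[of _ T]) auto
qed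

lemma orthogonal_generators_minimal:
  assumes "minimal_generating_set Q I (S :: (_ \<Rightarrow> 'k) set)"
  shows "minimal_generating_set Q (orthogonal_ideal Q I S) (orthogonal_generators Q I S)"
proof -
  let ?P = "orthogonal_generators Q I S"
  have char2: "(commutator Q a b :: _ \<Rightarrow> 'k) = anticommutator Q a b"
    if "distinct_loops Q a b" "distinct_loops Q c d"
      "(commutator Q c d :: _ \<Rightarrow> 'k) = anticommutator Q a b" for a b c d
  proof -
    have "{a, b} = {c, d}"
      using relation_determines_loops[OF that(1,2), of "anticommutator Q a b"] that(3) by simp
    then consider "a = c" "b = d" | "a = d" "b = c" by (auto simp: doubleton_eq_iff)
    then show ?thesis
    proof cases
      case 1
      with that(3) show ?thesis by simp
    next
      case 2
      have "commutator Q c d (tail Q a, [a, b]) = (anticommutator Q a b (tail Q a, [a, b]) :: 'k)"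
        using that(3) by simp
      then have "(- 1 :: 'k) = 1"
        using 2 that(1,2)
        by (auto simp: commutator_eq anticommutator_eq distinct_loops_def split: if_splits)
      then show ?thesis
        by (auto simp: commutator_eq[OF that(1)] anticommutator_eq[OF that(1)] fun_eq_iff)
    qed
  qed
  have "?P \<subseteq> anticommutativity_relations Q" if "S \<subseteq> commutativity_relations Q"
  proof -
    have "commutator Q a b \<in> (anticommutativity_relations Q :: (_ \<Rightarrow> 'k) set)"
      if ab: "distinct_loops Q a b" and "anticommutator Q a b \<in> S" for a b
    proof -
      have "anticommutator Q a b \<in> (commutativity_relations Q :: (_ \<Rightarrow> 'k) set)"
        using that \<open>S \<subseteq> _\<close> by auto
      with relation_neq_quad(2)[OF ab] obtain c d where
        "(anticommutator Q a b :: _ \<Rightarrow> 'k) = commutator Q c d" "distinct_loops Q c d"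
        unfolding commutativity_relations_def by blast
      then have "(commutator Q a b :: _ \<Rightarrow> 'k) = anticommutator Q a b"
        using char2 ab by metis
      with ab show ?thesis by (auto simp: anticommutativity_relations_def)
    qed
    then show ?thesis
      by (auto simp: orthogonal_generators_def anticommutativity_relations_def)
  qed
  moreover have "?P \<subseteq> commutativity_relations Q" if "S \<subseteq> anticommutativity_relations Q"
  proof -
    have "anticommutator Q a b \<in> (commutativity_relations Q :: (_ \<Rightarrow> 'k) set)"
      if ab: "distinct_loops Q a b" and "commutator Q a b \<in> S" for a b
    proof -
      have "commutator Q a b \<in> (anticommutativity_relations Q :: (_ \<Rightarrow> 'k) set)"
        using that \<open>S \<subseteq> _\<close> by auto
      with relation_neq_quad(1)[OF ab] obtain c d where
        cd: "(commutator Q a b :: _ \<Rightarrow> 'k) = anticommutator Q c d" "distinct_loops Q c d"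
        unfolding anticommutativity_relations_def by blast
      then have "(commutator Q c d :: _ \<Rightarrow> 'k) = anticommutator Q c d"
        using char2 ab by metis
      moreover have "{a, b} = {c, d}"
        using relation_determines_loops[OF ab cd(2), of "commutator Q a b"] cd(1) by simp
      ultimately have "(anticommutator Q a b :: _ \<Rightarrow> 'k) = commutator Q c d"
        using anticommutator_commute[of a b] by (auto simp: doubleton_eq_iff)
      with cd(2) show ?thesis by (auto simp: commutativity_relations_def)
    qed
    then show ?thesis
      by (auto simp: orthogonal_generators_def commutativity_relations_def)
  qed
  moreover have "quad Q a b \<notin> ?P \<and> quad Q b a \<notin> ?P" if l: "linked Q ?P a b" for a b
  proof -
    have ab: "distinct_loops Q a b" "distinct_loops Q b a"
      using l by (auto simp: linked_def distinct_loops_def)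
    obtain g where g: "g \<in> ?P" "g \<in> {commutator Q a b, commutator Q b a, anticommutator Q a b}"
      using l by (auto simp: linked_def)
    have "g \<noteq> quad Q c d" for c d
      using g(2)
    proof (elim insertE emptyE)
    qed (use relation_neq_quad[OF ab(1), of c d] relation_neq_quad(1)[OF ab(2), of c d] in auto)
    with g(1) consider
        c d where "distinct_loops Q c d" "commutator Q c d \<in> S" "g = anticommutator Q c d"
      | c d where "distinct_loops Q c d" "anticommutator Q c d \<in> S" "g = commutator Q c d"
      unfolding orthogonal_generators_def by blast
    then obtain c d where cd: "distinct_loops Q c d" "linked Q S c d"
      "g \<in> {commutator Q c d, commutator Q d c, anticommutator Q c d}"
      unfolding linked_def by cases blast+
    have "{a, b} = {c, d}" by (rule relation_determines_loops[OF ab(1) cd(1) g(2) cd(3)])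
    with cd(2) linked_commute[OF cd(2)] have lS: "linked Q S a b" "linked Q S b a"
      by (auto simp: doubleton_eq_iff)
    have "quad Q x y \<notin> ?P" if xy: "linked Q S x y" for x y
    proof
      have d: "distinct_loops Q x y" using xy by (simp add: linked_def)
      then have co: "composable Q x y" by (simp add: composable_def distinct_loops_def)
      assume "quad Q x y \<in> ?P"
      then obtain c d where "(quad Q x y :: _ \<Rightarrow> 'k) = quad Q c d" "\<not> linked Q S c d"
        unfolding orthogonal_generators_def
        using relation_neq_quad[symmetric] by blast
      with quad_inj[OF _ co] xy show False by blast
    qed
    with lS show ?thesis by blast
  qed
  ultimately show ?thesis
    using assms unfolding minimal_generating_set_def orthogonal_ideal_def by blast
qed

end

end

theory Submission
  imports Defs
begin

text \<open>
  The directed edges of the generator graph of the orthogonal ideal are the composable pairs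
  \<open>(a, b)\<close> that occur in no relation of \<open>I\<close>, neither as a monomial nor in an (anti-)commutator. Every
  element of \<open>I\<close> has coefficient zero at a path all of whose consecutive pairs are such edges, so
  running around a directed cycle gives arbitrarily long paths outside \<open>I\<close>. Conversely, if a path
  outside \<open>I\<close> has two consecutive arrows that do not form an edge, these are distinct loops and may
  be exchanged up to sign modulo \<open>I\<close>. If such a path repeats an arrow \<open>a\<close>, exchanges bring the two
  occurrences together and thereby exhibit a directed cycle through \<open>a\<close>. Without cycles, all paths
  longer than the number of arrows therefore lie in \<open>I\<close>.
\<close>

section \<open>Absorbing subsets as ideals, and directed cycles as closed walks\<close>

text \<open>Negation is covered by absorption, since \<open>\<ominus> x\<close> is
  \<open>\<ominus> \<one> \<otimes> x\<close>.\<close>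

lemma (in ring) ideal_of_mult_closed:
  assumes "K \<subseteq> carrier R" "\<zero> \<in> K"
    and "\<And>x y. x \<in> K \<Longrightarrow> y \<in> K \<Longrightarrow> x \<oplus> y \<in> K"
    and "\<And>a x. a \<in> carrier R \<Longrightarrow> x \<in> K \<Longrightarrow> a \<otimes> x \<in> K"
    and "\<And>a x. a \<in> carrier R \<Longrightarrow> x \<in> K \<Longrightarrow> x \<otimes> a \<in> K"
  shows "ideal K R"
proof (rule idealI[OF ring_axioms])
  show "subgroup K (add_monoid R)"
  proof (rule add.subgroupI)
    fix x assume x: "x \<in> K"
    have "\<ominus> \<one> \<otimes> x \<in> K" using assms(4) x by simp
    then show "\<ominus> x \<in> K" using x assms(1) by (simp add: l_minus subset_iff)
  qed (use assms in auto)
qed (use assms in auto)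

text \<open>Links the cyclic lists to the transitive closure, the form in which the commutation
  argument delivers a cycle.\<close>

lemma directed_cycle_iff_trancl:
  "has_directed_cycle G \<longleftrightarrow> (\<exists>a. (a, a) \<in> (directed_edges G)\<^sup>+)"
proof
  assume "has_directed_cycle G"
  then obtain as where as: "as \<noteq> []"
    "\<And>i. i < length as \<Longrightarrow> (as ! i, as ! (Suc i mod length as)) \<in> directed_edges G"
    by (auto simp: has_directed_cycle_def)
  let ?n = "length as"
  \<comment> \<open>Indices are taken modulo \<open>?n\<close> so that the closing edge has the same
    form as the others.\<close>
  have "(as ! (0 mod ?n), as ! (?n mod ?n)) \<in> directed_edges G ^^ ?n"
    unfolding relpow_fun_conv
    by (rule exI[of _ "\<lambda>i. as ! (i mod ?n)"]) (use as in auto)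
  then have "(as ! 0, as ! 0) \<in> (directed_edges G)\<^sup>+"
    using as(1) by (auto simp: trancl_power)
  then show "\<exists>a. (a, a) \<in> (directed_edges G)\<^sup>+" ..
next
  assume "\<exists>a. (a, a) \<in> (directed_edges G)\<^sup>+"
  then obtain a n where n: "n > 0" "(a, a) \<in> directed_edges G ^^ n"
    by (auto simp: trancl_power)
  then obtain f where f: "f 0 = a" "f n = a" "\<And>i. i < n \<Longrightarrow> (f i, f (Suc i)) \<in> directed_edges G"
    by (auto simp: relpow_fun_conv)
  \<comment> \<open>At \<open>Suc i = n\<close> the index wraps to 0, where \<open>f\<close> takes
    the same value \<open>a\<close> as at \<open>n\<close>.\<close>
  have "(f i, f (Suc i mod n)) \<in> directed_edges G" if "i < n" for i
    using f that by (cases "Suc i = n") force+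
  with n show "has_directed_cycle G"
    unfolding has_directed_cycle_def by (intro exI[of _ "map f [0..<n]"]) simp
qed

text \<open>Going round the cycle as often as needed gives words of every length.\<close>

lemma directed_cycle_word:
  assumes "has_directed_cycle G"
  shows "\<exists>w. length w = n \<and> successively (\<lambda>a b. (a, b) \<in> directed_edges G) w"
proof -
  obtain as where as: "as \<noteq> []"
    "\<And>i. i < length as \<Longrightarrow> (as ! i, as ! (Suc i mod length as)) \<in> directed_edges G"
    using assms by (auto simp: has_directed_cycle_def)
  have "(as ! (i mod length as), as ! (Suc i mod length as)) \<in> directed_edges G" for i
    using as(2)[of "i mod length as"] as(1) by (simp add: mod_Suc_eq)
  then show ?thesis
    by (intro exI[of _ "map (\<lambda>i. as ! (i mod length as)) [0..<n]"])
      (simp add: successively_conv_nth)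
qed

section \<open>Moving letters in words under partial commutation\<close>

text \<open>
  Read \<open>N\<close> as the set of words that are non-zero modulo an ideal, and \<open>E\<close> as the pairs of
  letters which occur in no relation. A letter that \<open>E\<close> reaches from \<open>a\<close> is stuck behind \<open>a\<close>; any
  other letter can be moved to the left past all stuck letters and \<open>a\<close> itself.
\<close>

lemma dependent_or_commuted:
  assumes swap: "\<And>p x y r. p @ x # y # r \<in> N \<Longrightarrow> (x, y) \<in> E \<or> x \<noteq> y \<and> p @ y # x # r \<in> N"
    and "p @ a # q @ c # r \<in> N" and "set q \<subseteq> E\<^sup>+ `` {a}"
  shows "(a, c) \<in> E\<^sup>+ \<or> c \<noteq> a \<and> p @ c # a # q @ r \<in> N"
  using assms(2,3)
proof (induction q arbitrary: r rule: rev_induct)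
  case Nil
  then show ?case using swap[of p a c r] by auto
next
  case (snoc d q)
  \<comment> \<open>The last stuck letter \<open>d\<close> is tested first: an edge to
    \<open>c\<close> extends the walk from \<open>a\<close>; otherwise \<open>d\<close> moves behind
    \<open>c\<close> and joins \<open>r\<close>.\<close>
  have "(d, c) \<in> E \<or> (p @ a # q) @ c # d # r \<in> N"
    using swap[of "p @ a # q" d c r] snoc.prems by auto
  then show ?case
  proof
    assume "(d, c) \<in> E"
    then show ?thesis using snoc.prems by (auto intro: trancl_into_trancl)
  next
    assume "(p @ a # q) @ c # d # r \<in> N"
    then show ?thesis using snoc.IH[of "d # r"] snoc.prems by auto
  qed
qed

text \<open>Induction on the unexamined block \<open>v\<close>: its first letter either is stuck and
  joins \<open>q\<close>, or moves in front of \<open>a\<close> and joins \<open>p\<close>. Once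
  \<open>v\<close> is empty, the second \<open>a\<close> meets the stuck block; as it cannot change
  places with the first \<open>a\<close>, it is itself reachable from \<open>a\<close>.\<close>

lemma cycle_of_repeated_letter:
  assumes swap: "\<And>p x y r. p @ x # y # r \<in> N \<Longrightarrow> (x, y) \<in> E \<or> x \<noteq> y \<and> p @ y # x # r \<in> N"
    and "p @ a # q @ v @ a # r \<in> N" and "set q \<subseteq> E\<^sup>+ `` {a}"
  shows "(a, a) \<in> E\<^sup>+"
  using assms(2,3)
proof (induction v arbitrary: p q)
  case Nil
  have "(a, a) \<in> E\<^sup>+ \<or> a \<noteq> a \<and> p @ a # a # q @ r \<in> N"
    by (rule dependent_or_commuted[OF swap]) (use Nil in auto)
  then show ?case by simp
next
  case (Cons c v)
  have "(a, c) \<in> E\<^sup>+ \<or> c \<noteq> a \<and> p @ c # a # q @ (v @ a # r) \<in> N"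
    by (rule dependent_or_commuted[OF swap]) (use Cons.prems in auto)
  then show ?case
    using Cons.IH[of p "q @ [c]"] Cons.IH[of "p @ [c]" q] Cons.prems by auto
qed

section \<open>Monomials of the path algebra\<close>

text \<open>The coefficient is part of the monomial so that scaling becomes multiplication by a
  multiple of a trivial path.\<close>

definition path_monom :: "('v, 'a) path \<Rightarrow> 'k \<Rightarrow> ('v, 'a) path \<Rightarrow> 'k::field" where
  "path_monom r c = (\<lambda>s. if s = r then c else 0)"

text \<open>Only the cut after \<open>length p\<close> arrows can contribute to the convolution
  sum.\<close>

lemma path_monom_mult:
  assumes "v = path_target Q u p"
  shows "path_monom (u, p) c \<otimes>\<^bsub>path_algebra Q\<^esub> path_monom (v, q) d = path_monom (u, p @ q) (c * d)"
proof (rule ext, clarify)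
  fix u' w
  have "(path_monom (u, p) c \<otimes>\<^bsub>path_algebra Q\<^esub> path_monom (v, q) d) (u', w) =
    (\<Sum>i\<le>length w. if i = length p then (if (u', w) = (u, p @ q) then c * d else 0) else 0)"
    unfolding path_algebra_mult
  proof (rule sum.cong)
    fix i assume i: "i \<in> {..length w}"
    show "path_monom (u, p) c (u', take i w) *
        path_monom (v, q) d (path_target Q u' (take i w), drop i w) =
      (if i = length p then if (u', w) = (u, p @ q) then c * d else 0 else 0)"
    proof (cases "take i w = p \<and> drop i w = q")
      case True
      then have "w = p @ q" "i = length p" using i by auto
      then show ?thesis using assms by (auto simp: path_monom_def)
    next
      case False
      then have "path_monom (u, p) c (u', take i w) = 0 \<or>
          path_monom (v, q) d (path_target Q u' (take i w), drop i w) = 0"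
        by (simp add: path_monom_def)
      then have "path_monom (u, p) c (u', take i w) *
          path_monom (v, q) d (path_target Q u' (take i w), drop i w) = 0" by simp
      moreover have "\<not> (i = length p \<and> w = p @ q)" using False by auto
      ultimately show ?thesis by auto
    qed
  qed simp
  also have "\<dots> = path_monom (u, p @ q) (c * d) (u', w)"
    by (auto simp: path_monom_def)
  finally show "(path_monom (u, p) c \<otimes>\<^bsub>path_algebra Q\<^esub> path_monom (v, q) d) (u', w) =
    path_monom (u, p @ q) (c * d) (u', w)" .
qed

lemma arrow_eq_path_monom: "arrow Q a = path_monom (tail Q a, [a]) 1"
  by (simp add: arrow_def path_monom_def)

lemma quad_eq_path_monom: "composable Q a b \<Longrightarrow> quad Q a b = path_monom (tail Q a, [a, b]) 1"
  by (auto simp: quad_eq path_monom_def composable_def)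

section \<open>Paths, and ideals cut out by conditions on coefficients\<close>

context
  fixes Q :: "('v, 'a) pre_digraph" and R :: "(('v, 'a) path \<Rightarrow> 'k::field) ring"
  assumes fin: "fin_digraph Q"
  defines R_def: "R \<equiv> path_algebra Q"
begin

interpretation fin_digraph Q by (fact fin)

interpretation ring R
  unfolding R_def by (rule path_algebra_ring[OF fin])

lemma mult_eq:
  "(x \<otimes>\<^bsub>R\<^esub> y) (u, p) =
     (\<Sum>i\<le>length p. x (u, take i p) * y (path_target Q u (take i p), drop i p))"
  unfolding R_def by (rule path_algebra_mult)

lemma carrier_iff: "x \<in> carrier R \<longleftrightarrow> finite {r. x r \<noteq> 0} \<and> {r. x r \<noteq> 0} \<subseteq> paths Q"
  unfolding R_def by (rule path_algebra_carrier)

lemma monom_mult: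
  "v = path_target Q u p \<Longrightarrow>
    path_monom (u, p) c \<otimes>\<^bsub>R\<^esub> path_monom (v, q) d = path_monom (u, p @ q) (c * d)"
  unfolding R_def by (rule path_monom_mult)

lemma paths_append_iff:
  "(u, p @ q) \<in> paths Q \<longleftrightarrow> (u, p) \<in> paths Q \<and> (path_target Q u p, q) \<in> paths Q"
  by (auto simp: paths_def path_target_def intro: awalk_appendI)

lemma paths_Cons_iff:
  "(u, a # p) \<in> paths Q \<longleftrightarrow> a \<in> arcs Q \<and> u = tail Q a \<and> (head Q a, p) \<in> paths Q"
  by (auto simp: paths_def awalk_Cons_iff)

lemma paths_Nil_iff: "(u, []) \<in> paths Q \<longleftrightarrow> u \<in> verts Q"
  by (auto simp: paths_def awalk_Nil_iff)

lemma path_target_Cons: "path_target Q u (a # p) = path_target Q (head Q a) p"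
  by (auto simp: path_target_def)

lemma path_monom_closed: "r \<in> paths Q \<Longrightarrow> path_monom r c \<in> carrier R"
  unfolding carrier_iff by (auto simp: path_monom_def)

text \<open>Membership in \<open>arcs Q\<close> is a separate condition because
  \<open>successively\<close> says nothing about a one-letter word.\<close>

lemma path_of_composable_word:
  assumes "successively (composable Q) w" "set w \<subseteq> arcs Q" "w \<noteq> []"
  shows "(tail Q (hd w), w) \<in> paths Q"
  using assms
proof (induction w)
  case (Cons a w)
  show ?case
  proof (cases w)
    case Nil
    then show ?thesis using Cons.prems by (auto simp: paths_Cons_iff paths_Nil_iff)
  next
    case (Cons b v)
    with Cons.prems Cons.IH show ?thesis
      by (auto simp: paths_Cons_iff composable_def)
  qed
qed simp

text \<open>When a path in \<open>W\<close> is cut, both parts lie in \<open>W\<close>, so each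
  summand of a product coefficient has a factor that vanishes.\<close>

lemma vanishing_ideal:
  assumes W: "\<And>u p q. (u, p @ q) \<in> W \<Longrightarrow> (u, p) \<in> W \<and> (path_target Q u p, q) \<in> W"
  shows "ideal {x \<in> carrier R. \<forall>r\<in>W. x r = 0} R"
proof (rule ideal_of_mult_closed)
  have W': "(u, take i p) \<in> W" "(path_target Q u (take i p), drop i p) \<in> W" if "(u, p) \<in> W" for u p i
    using W[of u "take i p" "drop i p"] that by auto
  fix a x assume "a \<in> carrier R" "x \<in> {x \<in> carrier R. \<forall>r\<in>W. x r = 0}"
  with W' show "a \<otimes>\<^bsub>R\<^esub> x \<in> {x \<in> carrier R. \<forall>r\<in>W. x r = 0}"
    "x \<otimes>\<^bsub>R\<^esub> a \<in> {x \<in> carrier R. \<forall>r\<in>W. x r = 0}"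
    by (auto simp: mult_eq)
next
  fix x y assume "x \<in> {x \<in> carrier R. \<forall>r\<in>W. x r = 0}" "y \<in> {x \<in> carrier R. \<forall>r\<in>W. x r = 0}"
  moreover from this have "x \<oplus>\<^bsub>R\<^esub> y \<in> carrier R" by auto
  ultimately show "x \<oplus>\<^bsub>R\<^esub> y \<in> {x \<in> carrier R. \<forall>r\<in>W. x r = 0}"
    by (auto simp: R_def path_algebra_add)
next
  have "\<zero>\<^bsub>R\<^esub> \<in> carrier R" by simp
  then show "\<zero>\<^bsub>R\<^esub> \<in> {x \<in> carrier R. \<forall>r\<in>W. x r = 0}"
    by (auto simp: R_def path_algebra_zero)
qed auto

text \<open>For elements without terms of length below 2, a factor on the left or right only
  rescales the coefficient at a path of length 2 by its own coefficient at the trivial path of the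
  origin or target. For loops at one vertex \<open>ab\<close> and \<open>ba\<close> are rescaled
  alike, so a linear condition on the two coefficients survives.\<close>

lemma quadratic_functional_ideal:
  assumes "s = 0 \<or> distinct_loops Q a b"
  shows "ideal {x \<in> carrier R. (\<forall>u p. length p < 2 \<longrightarrow> x (u, p) = 0) \<and>
    x (tail Q a, [a, b]) + s * x (tail Q a, [b, a]) = 0} R" (is "ideal ?K R")
proof (rule ideal_of_mult_closed)
  fix y x assume y: "y \<in> carrier R" and x: "x \<in> ?K"
  have low: "(y \<otimes>\<^bsub>R\<^esub> x) (u, p) = 0" "(x \<otimes>\<^bsub>R\<^esub> y) (u, p) = 0" if "length p < 2" for u p
    using x that by (auto simp: mult_eq intro!: sum.neutral)
  have l: "(y \<otimes>\<^bsub>R\<^esub> x) (u, [c, d]) = y (u, []) * x (u, [c, d])" for u c d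
    using x by (simp add: mult_eq numeral_2_eq_2)
  have r: "(x \<otimes>\<^bsub>R\<^esub> y) (u, [c, d]) = x (u, [c, d]) * y (head Q d, [])" for u c d
    using x by (simp add: mult_eq numeral_2_eq_2 path_target_Cons)
  \<comment> \<open>Right factors rescale \<open>ab\<close> at \<open>head Q b\<close> and
    \<open>ba\<close> at \<open>head Q a\<close>; these must agree unless \<open>s = 0\<close>
    removes \<open>ba\<close>.\<close>
  have h: "s = 0 \<or> head Q a = head Q b" using assms by (auto simp: distinct_loops_def)
  have "(y \<otimes>\<^bsub>R\<^esub> x) (tail Q a, [a, b]) + s * (y \<otimes>\<^bsub>R\<^esub> x) (tail Q a, [b, a]) =
      y (tail Q a, []) * (x (tail Q a, [a, b]) + s * x (tail Q a, [b, a]))"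
    unfolding l by (simp add: algebra_simps)
  with low x y show "y \<otimes>\<^bsub>R\<^esub> x \<in> ?K" by simp
  have "(x \<otimes>\<^bsub>R\<^esub> y) (tail Q a, [a, b]) + s * (x \<otimes>\<^bsub>R\<^esub> y) (tail Q a, [b, a]) =
      (x (tail Q a, [a, b]) + s * x (tail Q a, [b, a])) * y (head Q b, [])"
    unfolding r using h by (auto simp: algebra_simps)
  with low x y show "x \<otimes>\<^bsub>R\<^esub> y \<in> ?K" by simp
next
  fix x y assume x: "x \<in> ?K" and y: "y \<in> ?K"
  have "(x (tail Q a, [a, b]) + s * x (tail Q a, [b, a])) +
    (y (tail Q a, [a, b]) + s * y (tail Q a, [b, a])) = 0" using x y by simp
  then have "(x (tail Q a, [a, b]) + y (tail Q a, [a, b])) +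
    s * (x (tail Q a, [b, a]) + y (tail Q a, [b, a])) = 0" by (simp add: algebra_simps)
  moreover have "x \<oplus>\<^bsub>R\<^esub> y \<in> carrier R" using x y by auto
  ultimately show "x \<oplus>\<^bsub>R\<^esub> y \<in> ?K"
    using x y by (auto simp: R_def path_algebra_add)
next
  have "\<zero>\<^bsub>R\<^esub> \<in> carrier R" by simp
  then show "\<zero>\<^bsub>R\<^esub> \<in> ?K" by (auto simp: R_def path_algebra_zero)
qed auto

section \<open>Minimal generating sets and the edges of the orthogonal generator graph\<close>

lemma minimal_generating_set_closed:
  "minimal_generating_set Q I (T :: (_ \<Rightarrow> 'k) set) \<Longrightarrow> T \<subseteq> carrier R"
  using generators_closed[OF fin] unfolding minimal_generating_set_def R_def by blast

lemma minimal_generating_set_ideal: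
  assumes "minimal_generating_set Q I (T :: (_ \<Rightarrow> 'k) set)"
  shows "ideal I R" "T \<subseteq> I" "\<And>K. ideal K R \<Longrightarrow> T \<subseteq> K \<Longrightarrow> I \<subseteq> K"
proof -
  have I: "I = Idl\<^bsub>R\<^esub> T" using assms by (simp add: minimal_generating_set_def R_def)
  note T = minimal_generating_set_closed[OF assms]
  show "ideal I R" "T \<subseteq> I" "\<And>K. ideal K R \<Longrightarrow> T \<subseteq> K \<Longrightarrow> I \<subseteq> K"
    unfolding I using genideal_ideal[OF T] genideal_self[OF T] genideal_minimal by auto
qed

text \<open>Shows that the monomials in a minimal generating set are determined by the ideal, so the
  directed edges do not depend on the choice of generators.\<close>

lemma quad_mem_minimal_generating_set:
  assumes min: "minimal_generating_set Q I (T :: (_ \<Rightarrow> 'k) set)"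
    and ab: "composable Q a b" and mem: "quad Q a b \<in> I"
  shows "quad Q a b \<in> T"
proof (rule ccontr)
  assume nT: "quad Q a b \<notin> T"
  \<comment> \<open>If \<open>ab\<close> occurs in \<open>ab - ba\<close> (\<open>ab + ba\<close>), then the sum (difference) of the coefficients at \<open>ab\<close>
    and \<open>ba\<close> vanishes on \<open>T\<close>, hence on \<open>I\<close>, but it is 1 at \<open>ab\<close>.\<close>
  define s :: 'k where "s = (if linked Q T a b then
    if T \<subseteq> commutativity_relations Q then 1 else - 1 else 0)"
  define K where "K = {x \<in> carrier R. (\<forall>u p. length p < 2 \<longrightarrow> x (u, p) = 0) \<and>
    x (tail Q a, [a, b]) + s * x (tail Q a, [b, a]) = 0}"
  have loops: "s = 0 \<or> distinct_loops Q a b" by (simp add: s_def linked_def)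
  have sub: "T \<subseteq> commutativity_relations Q \<or> T \<subseteq> anticommutativity_relations Q"
    and nlT: "linked Q T a b \<Longrightarrow> quad Q b a \<notin> T"
    using min by (auto simp: minimal_generating_set_def)
  have "T \<subseteq> K"
  proof
    fix g assume g: "g \<in> T"
    have gc: "g \<in> carrier R" using minimal_generating_set_closed[OF min] g by blast
    have link: "linked Q T a b" if "distinct_loops Q c d" "{c, d} = {a, b}"
      "g = commutator Q c d \<or> g = anticommutator Q c d" for c d
    proof -
      have "linked Q T c d" using that g by (auto simp: linked_def)
      with linked_commute[OF fin this] that(2) show ?thesis by (auto simp: doubleton_eq_iff)
    qed
    \<comment> \<open>The cases repeat the test in the definition of \<open>s\<close>, so the sign
      in the relation matches \<open>s\<close> even if \<open>T\<close> fits both families.\<close>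
    consider (q) c d where "composable Q c d" "g = quad Q c d"
      | (c) c d where "distinct_loops Q c d" "g = commutator Q c d" "T \<subseteq> commutativity_relations Q"
      | (a) c d where "distinct_loops Q c d" "g = anticommutator Q c d"
          "\<not> T \<subseteq> commutativity_relations Q"
      using sub g unfolding commutativity_relations_def anticommutativity_relations_def by blast
    then show "g \<in> K"
    proof cases
      case q
      have "g (tail Q a, [a, b]) = 0" using q nT g by (auto simp: quad_eq)
      \<comment> \<open>If \<open>s\<close> is non-zero, the pair is linked and minimality keeps
        \<open>ba\<close> out of \<open>T\<close>.\<close>
      moreover have "s * g (tail Q a, [b, a]) = 0"
        using q nlT g by (auto simp: quad_eq s_def)
      ultimately show ?thesis using gc q by (auto simp: K_def quad_eq)
    next
      case c
      have "g (tail Q a, [a, b]) + s * g (tail Q a, [b, a]) = 0"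
      proof (cases "{c, d} = {a, b}")
        case True
        then have l: "linked Q T a b" using link c by blast
        then have "a \<noteq> b" "tail Q b = tail Q a" by (auto simp: linked_def distinct_loops_def)
        moreover have "s = 1" using l c(3) by (simp add: s_def)
        moreover have "c = a \<and> d = b \<or> c = b \<and> d = a" using True by (simp add: doubleton_eq_iff)
        ultimately show ?thesis
          unfolding c(2) commutator_eq[OF fin c(1)] by (elim disjE conjE) simp_all
      next
        case False
        then have n: "[a, b] \<noteq> [c, d]" "[a, b] \<noteq> [d, c]" "[b, a] \<noteq> [c, d]" "[b, a] \<noteq> [d, c]"
          by auto
        show ?thesis
          unfolding c(2) commutator_eq[OF fin c(1)]
          by (simp only: prod.inject n simp_thms if_False mult_zero_right add_0_right)
      qed
      moreover have "g (u, p) = 0" if "length p < 2" for u p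
        using that by (auto simp: c(2) commutator_eq[OF fin c(1)])
      ultimately show ?thesis unfolding K_def using gc by blast
    next
      case a
      have "g (tail Q a, [a, b]) + s * g (tail Q a, [b, a]) = 0"
      proof (cases "{c, d} = {a, b}")
        case True
        then have l: "linked Q T a b" using link a by blast
        then have "a \<noteq> b" "tail Q b = tail Q a" by (auto simp: linked_def distinct_loops_def)
        moreover have "s = - 1" using l a(3) by (simp add: s_def)
        moreover have "c = a \<and> d = b \<or> c = b \<and> d = a" using True by (simp add: doubleton_eq_iff)
        ultimately show ?thesis
          unfolding a(2) anticommutator_eq[OF fin a(1)] by (elim disjE conjE) simp_all
      next
        case False
        then have n: "[a, b] \<noteq> [c, d]" "[a, b] \<noteq> [d, c]" "[b, a] \<noteq> [c, d]" "[b, a] \<noteq> [d, c]"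
          by auto
        show ?thesis
          unfolding a(2) anticommutator_eq[OF fin a(1)]
          by (simp only: prod.inject n simp_thms if_False mult_zero_right add_0_right)
      qed
      moreover have "g (u, p) = 0" if "length p < 2" for u p
        using that by (auto simp: a(2) anticommutator_eq[OF fin a(1)])
      ultimately show ?thesis unfolding K_def using gc by blast
    qed
  qed
  then have "quad Q a b \<in> K"
    using minimal_generating_set_ideal(3)[OF min quadratic_functional_ideal[OF loops]] mem
    unfolding K_def by blast
  then have "quad Q a b (tail Q a, [a, b]) + s * quad Q a b (tail Q a, [b, a]) = 0"
    unfolding K_def by blast
  moreover have "quad Q a b (tail Q a, [a, b]) = (1 :: 'k)"
    by (simp add: quad_eq_path_monom[OF ab] path_monom_def)
  moreover have "s * quad Q a b (tail Q a, [b, a]) = 0"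
  proof (cases "a = b")
    case True
    with loops have "s = 0" by (simp add: distinct_loops_def)
    then show ?thesis by simp
  next
    case False
    then show ?thesis by (simp add: quad_eq_path_monom[OF ab] path_monom_def)
  qed
  ultimately show False by simp
qed

text \<open>Both \<open>P\<close> and \<open>orthogonal_generators Q I S\<close> are minimal
  generating sets of the same ideal, hence contain the same monomials; for the latter these can be
  read off.\<close>

lemma directed_edges_orthogonal:
  assumes S: "minimal_generating_set Q I (S :: (_ \<Rightarrow> 'k) set)"
    and P: "minimal_generating_set Q (orthogonal_ideal Q I S) P"
  shows "directed_edges (generator_graph Q P) =
    {(a, b). composable Q a b \<and> quad Q a b \<notin> I \<and> \<not> linked Q S a b}"
proof -
  let ?G = "orthogonal_generators Q I S"
  note G = orthogonal_generators_minimal[OF fin S]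
  have "quad Q a b \<in> P \<longleftrightarrow> quad Q a b \<in> ?G" if "composable Q a b" for a b
    using quad_mem_minimal_generating_set[OF P that] quad_mem_minimal_generating_set[OF G that]
      minimal_generating_set_ideal(2)[OF P] minimal_generating_set_ideal(2)[OF G] by blast
  moreover have "quad Q a b \<in> ?G \<longleftrightarrow> quad Q a b \<notin> I \<and> \<not> linked Q S a b"
    if "composable Q a b" for a b
    using that relation_neq_quad[OF fin, symmetric] quad_inj[OF fin _ that]
    unfolding orthogonal_generators_def by blast
  ultimately show ?thesis by (auto simp: generator_graph_def)
qed

section \<open>Powers of the arrow ideal\<close>

lemma arrow_ideal_ideal: "ideal (arrow_ideal Q) R"
  and arrow_mem_arrow_ideal: "a \<in> arcs Q \<Longrightarrow> arrow Q a \<in> (arrow_ideal Q :: (_ \<Rightarrow> 'k) set)"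
  and arrow_ideal_vanishes: "x \<in> (arrow_ideal Q :: (_ \<Rightarrow> 'k) set) \<Longrightarrow> x (u, []) = 0"
proof -
  let ?A = "arrow Q ` arcs Q :: (_ \<Rightarrow> 'k) set"
  have c: "?A \<subseteq> carrier R"
    by (auto simp: arrow_eq_path_monom paths_Cons_iff paths_Nil_iff intro!: path_monom_closed)
  show "ideal (arrow_ideal Q) R"
    using genideal_ideal[OF c] by (simp add: arrow_ideal_def R_def)
  show "a \<in> arcs Q \<Longrightarrow> arrow Q a \<in> (arrow_ideal Q :: (_ \<Rightarrow> 'k) set)"
    using genideal_self[OF c] by (auto simp: arrow_ideal_def R_def)
  let ?K = "{x \<in> carrier R. \<forall>r\<in>{(u, []) | u. True}. x r = 0}"
  have "ideal ?K R" by (rule vanishing_ideal) auto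
  moreover have "?A \<subseteq> ?K" using c by (auto simp: arrow_def)
  ultimately have "arrow_ideal Q \<subseteq> ?K"
    using genideal_minimal by (auto simp: arrow_ideal_def R_def)
  then show "x \<in> (arrow_ideal Q :: (_ \<Rightarrow> 'k) set) \<Longrightarrow> x (u, []) = 0" by auto
qed

lemma ideal_pow_arrow_ideal: "ideal (ideal_pow R (arrow_ideal Q) n) R"
  by (induction n) (simp_all add: oneideal ideal_prod_is_ideal arrow_ideal_ideal)

lemma path_monom_mem_ideal_pow:
  "(u, p) \<in> paths Q \<Longrightarrow> path_monom (u, p) 1 \<in> ideal_pow R (arrow_ideal Q) (length p)"
proof (induction p arbitrary: u)
  case Nil
  then show ?case by (simp add: path_monom_closed)
next
  case (Cons a p)
  then have a: "a \<in> arcs Q" "u = tail Q a" "(head Q a, p) \<in> paths Q"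
    by (simp_all add: paths_Cons_iff)
  have "arrow Q a \<otimes>\<^bsub>R\<^esub> path_monom (head Q a, p) 1 = path_monom (u, a # p) 1"
    using monom_mult[of "head Q a" u "[a]" 1 p 1] a(2)
    by (simp add: arrow_eq_path_monom path_target_Cons)
  with ideal_prod.prod[OF arrow_mem_arrow_ideal[OF a(1)] Cons.IH[OF a(3)], of R] show ?case by simp
qed

text \<open>The cut before the first arrow contributes nothing, because the arrow ideal vanishes at
  trivial paths; every other cut leaves a shorter path to the second factor.\<close>

lemma ideal_pow_vanishes:
  "x \<in> ideal_pow R (arrow_ideal Q) n \<Longrightarrow> length p < n \<Longrightarrow> x (u, p) = 0"
proof (induction n arbitrary: x u p)
  case (Suc n)
  from Suc.prems(1) have "x \<in> ideal_prod R (arrow_ideal Q) (ideal_pow R (arrow_ideal Q) n)" by simp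
  then show ?case
    using Suc.prems(2)
  proof (induction arbitrary: u p)
    case (prod i j)
    show ?case
      unfolding mult_eq
    proof (rule sum.neutral, intro ballI)
      fix k assume k: "k \<in> {..length p}"
      show "i (u, take k p) * j (path_target Q u (take k p), drop k p) = 0"
      proof (cases k)
        case 0
        then show ?thesis using arrow_ideal_vanishes[OF prod(1)] by simp
      next
        case (Suc l)
        then show ?thesis using Suc.IH[OF prod(2)] prod(3) k by simp
      qed
    qed
  next
    case (sum x y)
    then show ?case by (simp add: R_def path_algebra_add)
  qed
qed simp

section \<open>Paths that are zero or non-zero modulo the ideal\<close>

text \<open>Induction on the finite support. A ring ideal is closed under scalars because these act
  through multiples of trivial paths.\<close>

lemma mem_ideal_of_monomials:
  assumes "ideal I R" "x \<in> carrier R" "\<And>r. x r \<noteq> 0 \<Longrightarrow> path_monom r 1 \<in> I"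
  shows "x \<in> I"
proof -
  interpret I: ideal I R by fact
  have scale: "path_monom r c \<in> I" if "path_monom r 1 \<in> I" "r \<in> paths Q" for r c
  proof -
    obtain u p where r: "r = (u, p)" by (cases r)
    have "(u, []) \<in> paths Q"
      using that(2) unfolding r by (auto simp: paths_def awalk_def)
    then have "path_monom (u, []) c \<otimes>\<^bsub>R\<^esub> path_monom (u, p) 1 \<in> I"
      using I.I_l_closed that(1) path_monom_closed unfolding r by blast
    then show ?thesis using monom_mult[of u u "[]" c p 1] by (simp add: r)
  qed
  \<comment> \<open>The element is quantified inside the induction because removing one term changes
    it.\<close>
  have "\<forall>x. {r. x r \<noteq> 0} = A \<longrightarrow> A \<subseteq> paths Q \<longrightarrow> (\<forall>r\<in>A. path_monom r 1 \<in> I) \<longrightarrow> x \<in> I"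
    if "finite A" for A
    using that
  proof induction
    case empty
    have "x = \<zero>\<^bsub>R\<^esub>" if "{r. x r \<noteq> 0} = {}" for x :: "_ \<Rightarrow> 'k"
      using that by (auto simp: R_def path_algebra_zero)
    then show ?case using I.zero_closed by blast
  next
    case (insert r A)
    show ?case
    proof (intro allI impI)
      fix x :: "_ \<Rightarrow> 'k"
      assume x: "{r. x r \<noteq> 0} = insert r A" "insert r A \<subseteq> paths Q"
        "\<forall>r\<in>insert r A. path_monom r 1 \<in> I"
      have "{s. (x(r := 0)) s \<noteq> 0} = A" using x(1) insert(2) by auto
      then have "x(r := 0) \<in> I" using insert.IH x by blast
      moreover have "path_monom r (x r) \<in> I" using scale x by blast
      ultimately have "path_monom r (x r) \<oplus>\<^bsub>R\<^esub> x(r := 0) \<in> I" by blast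
      also have "path_monom r (x r) \<oplus>\<^bsub>R\<^esub> x(r := 0) = x"
        by (auto simp: R_def path_algebra_add path_monom_def)
      finally show "x \<in> I" .
    qed
  qed
  then show ?thesis using assms unfolding carrier_iff by blast
qed

text \<open>Modulo \<open>I\<close>, the products \<open>ab\<close> and \<open>ba\<close> agree up
  to sign.\<close>

lemma swap_linked:
  assumes "ideal I R" "S \<subseteq> I" "linked Q S a b" and l: "l \<in> carrier R" and r: "r \<in> carrier R"
    and ba: "l \<otimes>\<^bsub>R\<^esub> quad Q b a \<otimes>\<^bsub>R\<^esub> r \<in> I"
  shows "l \<otimes>\<^bsub>R\<^esub> quad Q a b \<otimes>\<^bsub>R\<^esub> r \<in> I"
proof -
  interpret I: ideal I R by fact
  have ab: "a \<in> arcs Q" "b \<in> arcs Q" using assms(3) by (auto simp: linked_def distinct_loops_def)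
  let ?x = "quad Q a b :: _ \<Rightarrow> 'k" and ?y = "quad Q b a :: _ \<Rightarrow> 'k"
  have xy: "?x \<in> carrier R" "?y \<in> carrier R"
    using quad_closed[OF fin] ab unfolding R_def by blast+
  \<comment> \<open>Here \<open>z\<close> is the linking generator up to sign, which reduces its
    three possible forms to two.\<close>
  obtain z where z: "z \<in> I" and x: "?x = z \<oplus>\<^bsub>R\<^esub> ?y \<or> ?x = z \<ominus>\<^bsub>R\<^esub> ?y"
  proof -
    from assms(3) consider "commutator Q a b \<in> S" | "commutator Q b a \<in> S" | "anticommutator Q a b \<in> S"
      unfolding linked_def by blast
    then show thesis
    proof cases
      case 1
      then have "?x \<ominus>\<^bsub>R\<^esub> ?y \<in> I" using assms(2) by (auto simp: commutator_def R_def)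
      moreover have "?x = (?x \<ominus>\<^bsub>R\<^esub> ?y) \<oplus>\<^bsub>R\<^esub> ?y"
        using xy by (simp add: a_minus_def a_assoc l_neg)
      ultimately show ?thesis using that by blast
    next
      case 2
      then have "?y \<ominus>\<^bsub>R\<^esub> ?x \<in> I" using assms(2) by (auto simp: commutator_def R_def)
      then have "\<ominus>\<^bsub>R\<^esub> (?y \<ominus>\<^bsub>R\<^esub> ?x) \<in> I" by (rule I.a_inv_closed)
      moreover have "?x = \<ominus>\<^bsub>R\<^esub> (?y \<ominus>\<^bsub>R\<^esub> ?x) \<oplus>\<^bsub>R\<^esub> ?y"
        using xy by (simp add: a_minus_def minus_add a_comm[of "\<ominus>\<^bsub>R\<^esub> ?y" ?x] a_assoc l_neg)
      ultimately show ?thesis using that by blast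
    next
      case 3
      then have "?x \<oplus>\<^bsub>R\<^esub> ?y \<in> I" using assms(2) by (auto simp: anticommutator_def R_def)
      moreover have "?x = (?x \<oplus>\<^bsub>R\<^esub> ?y) \<ominus>\<^bsub>R\<^esub> ?y"
        using xy by (simp add: a_minus_def a_assoc r_neg)
      ultimately show ?thesis using that by blast
    qed
  qed
  have zc: "z \<in> carrier R" using z by simp
  have lz: "l \<otimes>\<^bsub>R\<^esub> z \<otimes>\<^bsub>R\<^esub> r \<in> I" using z l r by (simp add: I.I_l_closed I.I_r_closed)
  from x show ?thesis
  proof
    assume x: "?x = z \<oplus>\<^bsub>R\<^esub> ?y"
    have "l \<otimes>\<^bsub>R\<^esub> ?x \<otimes>\<^bsub>R\<^esub> r = l \<otimes>\<^bsub>R\<^esub> z \<otimes>\<^bsub>R\<^esub> r \<oplus>\<^bsub>R\<^esub> l \<otimes>\<^bsub>R\<^esub> ?y \<otimes>\<^bsub>R\<^esub> r"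
      unfolding x using l r zc xy by (simp add: r_distr l_distr)
    then show ?thesis using lz ba by simp
  next
    assume x: "?x = z \<ominus>\<^bsub>R\<^esub> ?y"
    have "l \<otimes>\<^bsub>R\<^esub> ?x \<otimes>\<^bsub>R\<^esub> r = l \<otimes>\<^bsub>R\<^esub> z \<otimes>\<^bsub>R\<^esub> r \<oplus>\<^bsub>R\<^esub> \<ominus>\<^bsub>R\<^esub> (l \<otimes>\<^bsub>R\<^esub> ?y \<otimes>\<^bsub>R\<^esub> r)"
      unfolding x a_minus_def using l r zc xy by (simp add: r_distr l_distr r_minus l_minus)
    then show ?thesis using lz ba by simp
  qed
qed

text \<open>Supplies the \<open>swap\<close> hypothesis of the word lemmas for paths outside
  \<open>I\<close>. The factor \<open>ab\<close> cannot lie in \<open>I\<close>, so a pair that is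
  no edge must be linked.\<close>

lemma nonzero_word_swap:
  assumes S: "minimal_generating_set Q I (S :: (_ \<Rightarrow> 'k) set)"
    and path: "(u, p @ a # b # q) \<in> paths Q" and nI: "path_monom (u, p @ a # b # q) 1 \<notin> I"
  shows "composable Q a b \<and> quad Q a b \<notin> I \<and> \<not> linked Q S a b \<or>
    a \<noteq> b \<and> (u, p @ b # a # q) \<in> paths Q \<and> path_monom (u, p @ b # a # q) 1 \<notin> I"
proof -
  interpret I: ideal I R by (rule minimal_generating_set_ideal(1)[OF S])
  have p: "(u, p) \<in> paths Q" and ab: "composable Q a b" "path_target Q u p = tail Q a"
    and q: "(head Q b, q) \<in> paths Q"
    using path by (auto simp: paths_append_iff paths_Cons_iff composable_def)
  \<comment> \<open>Stated for any pair with the endpoints of \<open>ab\<close>, so that it also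
    serves for \<open>ba\<close>.\<close>
  have fac: "path_monom (u, p @ x # y # q) 1 =
      path_monom (u, p) 1 \<otimes>\<^bsub>R\<^esub> quad Q x y \<otimes>\<^bsub>R\<^esub> path_monom (head Q b, q) 1"
    if "composable Q x y" "tail Q x = tail Q a" "head Q y = head Q b" for x y
  proof -
    have "path_monom (u, p) 1 \<otimes>\<^bsub>R\<^esub> quad Q x y = path_monom (u, p @ [x, y]) 1"
      using that ab monom_mult[of "tail Q x" u p 1 "[x, y]" 1] by (simp add: quad_eq_path_monom)
    moreover have "path_target Q u (p @ [x, y]) = head Q b"
      using that by (simp add: path_target_append path_target_Cons)
    ultimately show ?thesis
      using monom_mult[of "head Q b" u "p @ [x, y]" 1 q 1] by simp
  qed
  note c = path_monom_closed[OF p, of 1] path_monom_closed[OF q, of 1]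
  have "quad Q a b \<notin> I"
    using nI fac[OF ab(1)] c by (auto simp: I.I_l_closed I.I_r_closed)
  moreover have "a \<noteq> b \<and> (u, p @ b # a # q) \<in> paths Q \<and> path_monom (u, p @ b # a # q) 1 \<notin> I"
    if l: "linked Q S a b"
  proof -
    have d: "distinct_loops Q a b" using l by (simp add: linked_def)
    then have ba: "composable Q b a" "tail Q b = tail Q a" "head Q a = head Q b"
      by (auto simp: composable_def distinct_loops_def)
    have "(u, p @ b # a # q) \<in> paths Q"
      using p q ab ba d by (auto simp: paths_append_iff paths_Cons_iff composable_def distinct_loops_def)
    moreover have "path_monom (u, p @ b # a # q) 1 \<notin> I"
      using nI fac[OF ab(1)] fac[OF ba]
        swap_linked[OF I.is_ideal minimal_generating_set_ideal(2)[OF S] l c] by auto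
    ultimately show ?thesis using d by (simp add: distinct_loops_def)
  qed
  ultimately show ?thesis using ab by blast
qed

text \<open>Words whose consecutive pairs all satisfy the condition are closed under cutting, and no
  generator has such a word in its support.\<close>

lemma minimal_generating_set_vanishes:
  assumes S: "minimal_generating_set Q I (S :: (_ \<Rightarrow> 'k) set)"
    and w: "successively (\<lambda>a b. quad Q a b \<notin> I \<and> \<not> linked Q S a b) w" and x: "x \<in> I"
  shows "x (u, w) = 0"
proof -
  let ?E = "\<lambda>a b. quad Q a b \<notin> I \<and> \<not> linked Q S a b"
  let ?W = "{(u, w). successively ?E w}"
  let ?K = "{x \<in> carrier R. \<forall>r\<in>?W. x r = 0}"
  have "ideal ?K R" by (rule vanishing_ideal) (auto simp: successively_append_iff)
  moreover have "S \<subseteq> ?K"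
  proof
    fix g assume g: "g \<in> S"
    have gc: "g \<in> carrier R" using minimal_generating_set_closed[OF S] g by blast
    have gI: "g \<in> I" using minimal_generating_set_ideal(2)[OF S] g by blast
    \<comment> \<open>Both orders are excluded, since the support of the relation contains
      \<open>cd\<close> and \<open>dc\<close>.\<close>
    have link: "linked Q S c d" "linked Q S d c" if "distinct_loops Q c d"
      "g = commutator Q c d \<or> g = anticommutator Q c d" for c d
    proof -
      show "linked Q S c d" using that g by (auto simp: linked_def)
      from linked_commute[OF fin this] show "linked Q S d c" .
    qed
    consider (q) c d where "composable Q c d" "g = quad Q c d"
      | (c) c d where "distinct_loops Q c d" "g = commutator Q c d \<or> g = anticommutator Q c d"
      using S g unfolding minimal_generating_set_def commutativity_relations_def
        anticommutativity_relations_def by blast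
    then show "g \<in> ?K"
    proof cases
      case q
      then show ?thesis using gc gI by (auto simp: quad_eq)
    next
      case c
      then show ?thesis using gc link[OF c]
        by (auto simp: commutator_eq[OF fin c(1)] anticommutator_eq[OF fin c(1)])
    qed
  qed
  ultimately have "I \<subseteq> ?K" by (rule minimal_generating_set_ideal(3)[OF S])
  with x w show ?thesis by auto
qed

section \<open>Admissibility and acyclicity\<close>

lemma minimal_generating_set_subset_square:
  assumes S: "minimal_generating_set Q I (S :: (_ \<Rightarrow> 'k) set)"
  shows "I \<subseteq> ideal_pow R (arrow_ideal Q) 2"
proof (rule minimal_generating_set_ideal(3)[OF S ideal_pow_arrow_ideal])
  interpret J2: ideal "ideal_pow R (arrow_ideal Q) 2" R by (rule ideal_pow_arrow_ideal)
  have q: "quad Q a b \<in> ideal_pow R (arrow_ideal Q) 2" if "composable Q a b" for a b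
    using path_monom_mem_ideal_pow[of "tail Q a" "[a, b]"] that
    by (auto simp: quad_eq_path_monom composable_def paths_Cons_iff paths_Nil_iff numeral_2_eq_2)
  have "commutator Q a b \<in> ideal_pow R (arrow_ideal Q) 2"
    "anticommutator Q a b \<in> ideal_pow R (arrow_ideal Q) 2" if "distinct_loops Q a b" for a b
    using q[of a b] q[of b a] that
    unfolding commutator_def anticommutator_def R_def[symmetric] a_minus_def
    by (auto simp: composable_def distinct_loops_def)
  with q S show "S \<subseteq> ideal_pow R (arrow_ideal Q) 2"
    unfolding minimal_generating_set_def commutativity_relations_def
      anticommutativity_relations_def by blast
qed

lemma admissible_iff_no_directed_cycle:
  assumes S: "minimal_generating_set Q I (S :: (_ \<Rightarrow> 'k) set)"
    and P: "minimal_generating_set Q (orthogonal_ideal Q I S) P"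
  shows "admissible Q I \<longleftrightarrow> \<not> has_directed_cycle (generator_graph Q P)"
proof
  let ?E = "directed_edges (generator_graph Q P)"
  note E = directed_edges_orthogonal[OF S P]
  {
    assume "admissible Q I"
    then obtain m where m: "m \<ge> 2" "ideal_pow R (arrow_ideal Q) m \<subseteq> I"
      by (auto simp: admissible_def R_def)
    show "\<not> has_directed_cycle (generator_graph Q P)"
    proof
      assume "has_directed_cycle (generator_graph Q P)"
      then obtain w where w: "length w = m" "successively (\<lambda>a b. (a, b) \<in> ?E) w"
        using directed_cycle_word by blast
      have comp: "successively (composable Q) w"
        by (rule successively_mono[OF w(2)]) (simp add: E)
      \<comment> \<open>The last letter has no successor, so its predecessor is used; it exists
        because \<open>m \<ge> 2\<close>.\<close>
      have "w ! i \<in> arcs Q" if "i < m" for i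
      proof (cases "Suc i < m")
        case True
        then show ?thesis using comp w(1) by (auto simp: successively_conv_nth composable_def)
      next
        case False
        with that m(1) w(1) have "Suc (i - 1) = i" "Suc (i - 1) < length w" by auto
        then show ?thesis using comp by (metis successively_conv_nth composable_def)
      qed
      then have "set w \<subseteq> arcs Q" using w(1) by (auto simp: set_conv_nth)
      moreover have "w \<noteq> []" using w(1) m(1) by auto
      ultimately have "(tail Q (hd w), w) \<in> paths Q"
        by (rule path_of_composable_word[OF comp])
      then have "path_monom (tail Q (hd w), w) 1 \<in> I"
        using path_monom_mem_ideal_pow w(1) m(2) by blast
      moreover have "successively (\<lambda>a b. quad Q a b \<notin> I \<and> \<not> linked Q S a b) w"
        by (rule successively_mono[OF w(2)]) (simp add: E)
      ultimately have "path_monom (tail Q (hd w), w) (1 :: 'k) (tail Q (hd w), w) = 0"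
        using minimal_generating_set_vanishes[OF S] by blast
      then show False by (simp add: path_monom_def)
    qed
  next
    assume acyclic: "\<not> has_directed_cycle (generator_graph Q P)"
    \<comment> \<open>A path outside \<open>I\<close> cannot repeat an arrow, as a repetition would
      give a cycle.\<close>
    have short: "length w \<le> card (arcs Q)"
      if w: "(u, w) \<in> paths Q" "path_monom (u, w) 1 \<notin> I" for u w
    proof -
      let ?N = "{w. (u, w) \<in> paths Q \<and> path_monom (u, w) 1 \<notin> I}"
      have swap: "(x, y) \<in> ?E \<or> x \<noteq> y \<and> p @ y # x # r \<in> ?N" if "p @ x # y # r \<in> ?N" for p x y r
        using nonzero_word_swap[OF S, of u p x y r] that unfolding E by blast
      have "distinct w"
      proof (rule ccontr)
        assume "\<not> distinct w"
        then obtain p v r a where "w = p @ [a] @ v @ [a] @ r"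
          using not_distinct_decomp by blast
        \<comment> \<open>The block of stuck letters starts empty.\<close>
        then have N: "p @ a # [] @ v @ a # r \<in> ?N" using w by simp
        have "(a, a) \<in> ?E\<^sup>+"
        proof (rule cycle_of_repeated_letter[OF _ N])
          fix p x y r assume "p @ x # y # r \<in> ?N"
          then show "(x, y) \<in> ?E \<or> x \<noteq> y \<and> p @ y # x # r \<in> ?N" by (rule swap)
        qed simp
        with acyclic show False by (auto simp: directed_cycle_iff_trancl)
      qed
      moreover have "set w \<subseteq> arcs Q" using w(1) by (auto simp: paths_def awalk_def)
      ultimately show ?thesis by (metis card_mono distinct_card finite_arcs)
    qed
    \<comment> \<open>Adding 2 makes the exponent exceed the bound in \<open>short\<close> and be at
      least 2 even when there are no arrows.\<close>
    let ?m = "card (arcs Q) + 2"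
    have "ideal_pow R (arrow_ideal Q) ?m \<subseteq> I"
    proof
      fix x assume x: "x \<in> ideal_pow R (arrow_ideal Q) ?m"
      then have xc: "x \<in> carrier R"
        using ideal.Icarr[OF ideal_pow_arrow_ideal] by blast
      show "x \<in> I"
      proof (rule mem_ideal_of_monomials[OF minimal_generating_set_ideal(1)[OF S] xc])
        fix r assume r: "x r \<noteq> 0"
        obtain u w where [simp]: "r = (u, w)" by (cases r)
        have "(u, w) \<in> paths Q" using xc r by (auto simp: carrier_iff)
        moreover have "length w \<ge> ?m"
          using ideal_pow_vanishes[OF x] r by (metis not_le \<open>r = (u, w)\<close>)
        ultimately show "path_monom r 1 \<in> I" using short by fastforce
      qed
    qed
    moreover have "2 \<le> ?m" by simp
    ultimately show "admissible Q I"
      using minimal_generating_set_ideal(1)[OF S] minimal_generating_set_subset_square[OF S]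
      unfolding admissible_def R_def by blast
  }
qed

end

theorem theorem3p13:
  fixes Q :: "('v, 'a) pre_digraph"
    and I I2 P2 :: "(('v, 'a) path \<Rightarrow> 'k::alg_closed_field) set"
  assumes "fin_digraph Q" and "connected Q"
    and "commutativity_ideal Q I \<or> anticommutativity_ideal Q I"
    and "minimal_generating_set Q I I2"
    and "minimal_generating_set Q (orthogonal_ideal Q I I2) P2"
  shows "admissible Q I \<longleftrightarrow> \<not> has_directed_cycle (generator_graph Q P2)"
  using admissible_iff_no_directed_cycle[OF assms(1,4,5)] .

end
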